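(* Let $K\subset\mathbb{R}^n$ be a closed convex set with diameter $d$, $\sigma>0$, and fix constants $C>1>c>0$. Define $$\overline{\varepsilon}:=\sup\Big\{\varepsilon:\ \sup_{\mu\in K}\big[w_\mu(C\varepsilon)-w_\mu(c\varepsilon)\big]\ge\frac{(C^2-c^2)\varepsilon^2}{2\sigma}\Big\}.$$ Then $\varepsilon_K\asymp\overline{\varepsilon}$ if $\overline{\varepsilon}\gtrsim\sigma$ (for a sufficiently large constant); otherwise $\varepsilon_K\asymp\sigma\wedge d$.
   Context: Gaussian sequence model: $Y=\mu+\xi$, $\mu\in K$, $\xi\sim N(0,\sigma^2\mathbb{I}_n)$; LSE $\hat\mu=\operatorname{argmin}_{\nu\in K}\|Y-\nu\|_2^2$; $\varepsilon_K^2=\sup_{\mu\in K}\mathbb{E}_\mu\|\hat\mu-\mu\|_2^2$. Local Gaussian width $w_\mu(\varepsilon)=\mathbb{E}\sup_{t\in B(\mu,\varepsilon)\cap K}\langle x,t\rangle$, $x\sim N(0,\mathbb{I}_n)$, $B$ the closed Euclidean ball. $\lesssim,\gtrsim,\asymp$ hide constants (depending only on the fixed constants). *)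

theory Defs
  imports "HOL-Probability.Probability"
begin

text \<open>Vectors of R^n are represented as functions nat => real; only the
coordinates i < n matter. This explicit carrier is used (instead of a finite
index type) so that the constants in the theorem can be stated uniformly in
the dimension n.\<close>

definition Rn :: "nat \<Rightarrow> (nat \<Rightarrow> real) set" where
  "Rn n = {v. \<forall>i\<ge>n. v i = 0}"

definition ip :: "nat \<Rightarrow> (nat \<Rightarrow> real) \<Rightarrow> (nat \<Rightarrow> real) \<Rightarrow> real" where
  "ip n u v = (\<Sum>i<n. u i * v i)"

definition edist :: "nat \<Rightarrow> (nat \<Rightarrow> real) \<Rightarrow> (nat \<Rightarrow> real) \<Rightarrow> real" where
  "edist n u v = sqrt (\<Sum>i<n. (u i - v i)^2)"

definition eclosed :: "nat \<Rightarrow> (nat \<Rightarrow> real) set \<Rightarrow> bool" where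
  "eclosed n K \<longleftrightarrow> (\<forall>f v. (\<forall>k. f k \<in> K) \<longrightarrow> v \<in> Rn n \<longrightarrow>
      (\<lambda>k. edist n (f k) v) \<longlonglongrightarrow> 0 \<longrightarrow> v \<in> K)"

definition econvex :: "(nat \<Rightarrow> real) set \<Rightarrow> bool" where
  "econvex K \<longleftrightarrow> (\<forall>u\<in>K. \<forall>v\<in>K. \<forall>t::real. 0 \<le> t \<and> t \<le> 1 \<longrightarrow>
      (\<lambda>i. (1 - t) * u i + t * v i) \<in> K)"

definition ebounded :: "nat \<Rightarrow> (nat \<Rightarrow> real) set \<Rightarrow> bool" where
  "ebounded n K \<longleftrightarrow> (\<exists>B. \<forall>u\<in>K. \<forall>v\<in>K. edist n u v \<le> B)"

definition ediam :: "nat \<Rightarrow> (nat \<Rightarrow> real) set \<Rightarrow> real" where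
  "ediam n K = Sup {edist n u v | u v. u \<in> K \<and> v \<in> K}"

definition gauss :: "nat \<Rightarrow> (nat \<Rightarrow> real) measure" where
  "gauss n = PiM {..<n} (\<lambda>_. density lborel std_normal_density)"

definition lse :: "nat \<Rightarrow> (nat \<Rightarrow> real) set \<Rightarrow> (nat \<Rightarrow> real) \<Rightarrow> (nat \<Rightarrow> real)" where
  "lse n K y = (THE \<nu>. \<nu> \<in> K \<and> (\<forall>\<nu>'\<in>K. (edist n y \<nu>)^2 \<le> (edist n y \<nu>')^2))"

text \<open>Observation Y = mu + sigma * x with x ~ N(0, I_n) (so xi = sigma x).\<close>

definition obs :: "nat \<Rightarrow> (nat \<Rightarrow> real) \<Rightarrow> real \<Rightarrow> (nat \<Rightarrow> real) \<Rightarrow> (nat \<Rightarrow> real)" where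
  "obs n \<mu> \<sigma> x = (\<lambda>i. if i < n then \<mu> i + \<sigma> * x i else 0)"

definition epsK :: "nat \<Rightarrow> (nat \<Rightarrow> real) set \<Rightarrow> real \<Rightarrow> real" where
  "epsK n K \<sigma> = sqrt (SUP \<mu>\<in>K.
      (\<integral>x. (edist n (lse n K (obs n \<mu> \<sigma> x)) \<mu>)^2 \<partial>gauss n))"

definition lgw :: "nat \<Rightarrow> (nat \<Rightarrow> real) set \<Rightarrow> (nat \<Rightarrow> real) \<Rightarrow> real \<Rightarrow> real" where
  "lgw n K \<mu> \<epsilon> = (\<integral>x. (SUP t\<in>{t\<in>K. edist n t \<mu> \<le> \<epsilon>}. ip n x t) \<partial>gauss n)"

definition epsbar :: "nat \<Rightarrow> (nat \<Rightarrow> real) set \<Rightarrow> real \<Rightarrow> real \<Rightarrow> real \<Rightarrow> real" where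
  "epsbar n K \<sigma> C c = Sup {\<epsilon>. 0 \<le> \<epsilon> \<and>
      (SUP \<mu>\<in>K. lgw n K \<mu> (C * \<epsilon>) - lgw n K \<mu> (c * \<epsilon>)) \<ge> (C^2 - c^2) * \<epsilon>^2 / (2 * \<sigma>)}"

end

theory Submission
  imports Defs
begin

text \<open>Fix \<open>\<mu> \<in> K\<close>, let \<open>h(s)\<close> be the supremum of \<open>\<langle>x, t - \<mu>\<rangle>\<close> over \<open>t \<in> K\<close> with \<open>\<parallel>t - \<mu>\<parallel> \<le> s\<close>, and let
\<open>r\<close> be the error of the least squares estimator. Expanding the square shows that, for each noise vector
\<open>x\<close>, the radius \<open>r\<close> maximises \<open>\<sigma> h(s) - s\<^sup>2/2\<close>. As \<open>h\<close> is concave in \<open>s\<close>, comparing slopes on both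
sides of \<open>[c\<epsilon>, C\<epsilon>]\<close> gives \<open>r \<le> max (C\<epsilon>) (2\<sigma> H / ((C - c)\<epsilon>))\<close> for \<open>H = h(C\<epsilon>) - h(c\<epsilon>)\<close>, and shows that
\<open>r \<le> c\<epsilon>/2\<close> forces \<open>H\<close> to be small. The mean of \<open>H\<close> is the difference of local Gaussian widths
that defines \<open>\<epsilon>\<close>-bar, and its standard deviation is \<open>O(\<epsilon>)\<close> by a Gaussian Poincare inequality, so second
moments alone give both bounds when \<open>\<epsilon>\<close>-bar dominates \<open>\<sigma>\<close>. The lower bound of order \<open>min \<sigma> d\<close> is a two-point argument
with a Gaussian change of measure.\<close>

section \<open>The standard Gaussian measure\<close>

text \<open>The change of regime at \<open>\<sigma>\<close> is a comparison of two scales. The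
  threshold defining \<open>epsbar\<close> is of order \<open>\<epsilon>^2 / \<sigma>\<close>, while
  the increment fluctuates by order \<open>\<epsilon>\<close>, so the lower bound needs
  \<open>\<epsilon>\<close> to exceed a large multiple of \<open>\<sigma>\<close>. The upper bound
  does not: the fluctuation only adds a multiple of \<open>\<sigma>\<close> to the error, so
  \<open>epsK\<close> is at most a constant times \<open>epsbar + \<sigma>\<close> in every case,
  and both regimes follow from this and the diameter bound. The variance bound has to be free of the
  dimension although \<open>h\<close> is a supremum without a usable gradient. It is proved by
  rotating a Gaussian vector into an independent copy of itself and cutting the arc into small
  angles, where a subgradient at the starting point is enough. The price is the constant 24 in place
  of the sharp 1, which the theorem does not see.\<close>

abbreviation std_gauss :: "real measure" where
  "std_gauss \<equiv> density lborel std_normal_density"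

lemma sets_std_gauss [measurable_cong]: "sets std_gauss = sets borel"
  by simp

interpretation std_gauss: prob_space std_gauss
  by (rule prob_space_normal_density) simp

interpretation pi_gauss: product_prob_space "\<lambda>_::nat. std_gauss" I for I
  by unfold_locales

lemma sets_gauss [measurable_cong]: "sets (gauss n) = sets (PiM {..<n} (\<lambda>_. borel))"
  unfolding gauss_def by (rule sets_PiM_cong) simp_all

lemma space_gauss: "space (gauss n) = extensional {..<n}"
  by (simp add: gauss_def space_PiM PiE_def)

interpretation gauss: prob_space "gauss n" for n
  unfolding gauss_def by (rule pi_gauss.P.prob_space_axioms)

section \<open>Moments of Gaussian coordinates and of linear functionals\<close>

lemma std_gauss_moments:
  "integrable std_gauss (\<lambda>y. y)" "(\<integral>y. y \<partial>std_gauss) = 0"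
  "integrable std_gauss (\<lambda>y. y * y)" "(\<integral>y. y * y \<partial>std_gauss) = 1"
proof -
  have 1: "has_bochner_integral lborel (\<lambda>y. std_normal_density y * y) 0"
    using std_normal_moment_odd[of 0] by simp
  have 2: "has_bochner_integral lborel (\<lambda>y. std_normal_density y * (y * y)) 1"
    using std_normal_moment_even[of 1] by (simp add: power2_eq_square)
  show "integrable std_gauss (\<lambda>y. y)" "(\<integral>y. y \<partial>std_gauss) = 0"
    using 1 by (simp_all add: integrable_density integral_density has_bochner_integral_iff)
  show "integrable std_gauss (\<lambda>y. y * y)" "(\<integral>y. y * y \<partial>std_gauss) = 1"
    using 2 by (simp_all add: integrable_density integral_density has_bochner_integral_iff)
qed

lemma gauss_coord:
  assumes "i < n"
  shows "integrable (gauss n) (\<lambda>x. x i)" "(\<integral>x. x i \<partial>gauss n) = 0"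
proof -
  have d: "std_gauss = distr (gauss n) std_gauss (\<lambda>x. x i)"
    unfolding gauss_def by (rule distr_PiM_component[symmetric]) (use assms std_gauss.prob_space_axioms in auto)
  have m: "(\<lambda>x. x i) \<in> measurable (gauss n) std_gauss"
    unfolding gauss_def using assms by (intro measurable_component_singleton) auto
  show "integrable (gauss n) (\<lambda>x. x i)"
    by (rule integrable_distr[OF m]) (use std_gauss_moments(1) d in metis)
  have "(\<integral>x. x i \<partial>gauss n) = (\<integral>y. y \<partial>distr (gauss n) std_gauss (\<lambda>x. x i))"
    by (rule integral_distr[OF m, symmetric]) simp
  then show "(\<integral>x. x i \<partial>gauss n) = 0"
    unfolding d[symmetric] by (simp only: std_gauss_moments)
qed

lemma gauss_coord_mult:
  assumes "i < n" "j < n"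
  shows "integrable (gauss n) (\<lambda>x. x i * x j)"
    and "(\<integral>x. x i * x j \<partial>gauss n) = (if i = j then 1 else 0)"
proof -
  \<comment> \<open>Every coordinate gets a factor, equal to 1 away from \<open>i\<close> and
    \<open>j\<close>. At \<open>k = i = j\<close> both conditionals fire and give
    \<open>y * y\<close>, so one product formula serves the diagonal and the off-diagonal
    case.\<close>
  let ?f = "\<lambda>k y::real. (if k = i then y else 1) * (if k = j then y else 1)"
  have prod: "(\<Prod>k<n. ?f k (x k)) = x i * x j" for x :: "nat \<Rightarrow> real"
    unfolding prod.distrib using assms by simp
  have int: "integrable std_gauss (?f k)" for k
    using std_gauss_moments by (cases "k = i"; cases "k = j") simp_all
  have m: "integral\<^sup>L std_gauss (?f k) = (if k = i \<and> i \<noteq> j \<or> k = j \<and> i \<noteq> j then 0 else 1)" for k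
    using std_gauss_moments std_gauss.prob_space by (cases "k = i"; cases "k = j") simp_all
  then have val: "(\<Prod>k<n. integral\<^sup>L std_gauss (?f k)) = (if i = j then 1 else 0)"
  proof (cases "i = j")
    case False
    then have "\<exists>k\<in>{..<n}. integral\<^sup>L std_gauss (?f k) = 0"
      using assms False by (intro bexI[of _ i]) (simp_all add: std_gauss_moments)
    then show ?thesis using False by (simp add: prod_zero)
  qed (simp add: m)
  show "integrable (gauss n) (\<lambda>x. x i * x j)"
    using pi_gauss.product_integrable_prod[of "{..<n}" ?f, OF finite_lessThan int] unfolding prod gauss_def .
  show "(\<integral>x. x i * x j \<partial>gauss n) = (if i = j then 1 else 0)"
    using pi_gauss.product_integral_prod[of "{..<n}" ?f, OF finite_lessThan int] unfolding prod gauss_def val .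
qed

lemma gauss_ip:
  shows "integrable (gauss n) (\<lambda>x. ip n x v)" "(\<integral>x. ip n x v \<partial>gauss n) = 0"
  unfolding ip_def using gauss_coord by (auto)

lemma gauss_ip_mult:
  shows "integrable (gauss n) (\<lambda>x. ip n x u * ip n x v)"
    and "(\<integral>x. ip n x u * ip n x v \<partial>gauss n) = ip n u v"
proof -
  have e: "ip n x u * ip n x v = (\<Sum>i<n. \<Sum>j<n. (u i * v j) * (x i * x j))" for x
    unfolding ip_def sum_product by (intro sum.cong) (auto simp: algebra_simps)
  show "integrable (gauss n) (\<lambda>x. ip n x u * ip n x v)"
    unfolding e by (intro Bochner_Integration.integrable_sum integrable_mult_right gauss_coord_mult) auto
  have "(\<integral>x. ip n x u * ip n x v \<partial>gauss n) = (\<Sum>i<n. \<integral>x. (\<Sum>j<n. (u i * v j) * (x i * x j)) \<partial>gauss n)"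
    unfolding e
    by (intro Bochner_Integration.integral_sum Bochner_Integration.integrable_sum integrable_mult_right gauss_coord_mult) auto
  also have "\<dots> = (\<Sum>i<n. \<Sum>j<n. \<integral>x. (u i * v j) * (x i * x j) \<partial>gauss n)"
    by (intro sum.cong refl Bochner_Integration.integral_sum integrable_mult_right gauss_coord_mult) auto
  also have "\<dots> = (\<Sum>i<n. \<Sum>j<n. (u i * v j) * (if i = j then 1 else 0))"
    by (intro sum.cong refl) (simp only: integral_mult_right_zero gauss_coord_mult lessThan_iff)
  also have "\<dots> = ip n u v"
    unfolding ip_def by (intro sum.cong refl) (simp add: if_distrib sum.delta cong: if_cong)
  finally show "(\<integral>x. ip n x u * ip n x v \<partial>gauss n) = ip n u v" .
qed

lemma gauss_sq:
  shows "integrable (gauss n) (\<lambda>x. ip n x x)" "(\<integral>x. ip n x x \<partial>gauss n) = n"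
  unfolding ip_def using gauss_coord_mult by (auto simp: Bochner_Integration.integral_sum)

section \<open>Reflection invariance of a pair of independent Gaussian vectors\<close>

lemma distr_gauss_pair:
  "distr (gauss n \<Otimes>\<^sub>M gauss n) (PiM {..<n} (\<lambda>_. std_gauss \<Otimes>\<^sub>M std_gauss))
     (\<lambda>(x, y). \<lambda>i\<in>{..<n}. (x i, y i)) = PiM {..<n} (\<lambda>_. std_gauss \<Otimes>\<^sub>M std_gauss)" (is "distr ?M ?P ?z = _")
proof -
  interpret pr: pair_prob_space std_gauss std_gauss by unfold_locales
  interpret pp: product_prob_space "\<lambda>_::nat. std_gauss \<Otimes>\<^sub>M std_gauss" "{..<n}"
    by unfold_locales
  have zm[measurable]: "?z \<in> measurable ?M ?P"
    by measurable
  show ?thesis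
  proof (rule pp.PiM_eqI)
    show "sets (distr ?M ?P ?z) = sets ?P" by simp
    fix A :: "nat \<Rightarrow> (real \<times> real) set"
    assume A: "\<And>i. i \<in> {..<n} \<Longrightarrow> A i \<in> sets (std_gauss \<Otimes>\<^sub>M std_gauss)"
    define f :: "nat \<Rightarrow> real \<Rightarrow> real \<Rightarrow> ennreal" where "f i a b = indicator (A i) (a, b)" for i a b
    have fm: "(\<lambda>p. f i (fst p) (snd p)) \<in> borel_measurable (std_gauss \<Otimes>\<^sub>M std_gauss)" if "i < n" for i
      using A that by (simp add: f_def)
    have fm2: "f i a \<in> borel_measurable std_gauss" if "i < n" for i a
      using measurable_compose[OF measurable_Pair1' fm[OF that], of a] by (simp add: comp_def)
    have fm3: "(\<lambda>a. \<integral>\<^sup>+b. f i a b \<partial>std_gauss) \<in> borel_measurable std_gauss" if "i < n" for i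
      using fm[OF that] by (intro std_gauss.borel_measurable_nn_integral) (simp add: split_beta')
    have B: "Pi\<^sub>E {..<n} A \<in> sets ?P"
      using A by (intro sets_PiM_I_finite) auto
    have ind: "indicator (Pi\<^sub>E {..<n} A) (?z (x, y)) = (\<Prod>i<n. f i (x i) (y i))" for x y
      by (auto simp: indicator_def f_def PiE_iff prod_zero_iff)
    have "emeasure (distr ?M ?P ?z) (Pi\<^sub>E {..<n} A) = (\<integral>\<^sup>+w. indicator (Pi\<^sub>E {..<n} A) w \<partial>distr ?M ?P ?z)"
      using B by simp
    also have "\<dots> = (\<integral>\<^sup>+p. indicator (Pi\<^sub>E {..<n} A) (?z p) \<partial>?M)"
      using B by (intro nn_integral_distr) auto
    also have "\<dots> = (\<integral>\<^sup>+x. \<integral>\<^sup>+y. indicator (Pi\<^sub>E {..<n} A) (?z (x, y)) \<partial>gauss n \<partial>gauss n)"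
      using B by (intro gauss.nn_integral_fst[symmetric]) simp
    also have "\<dots> = (\<integral>\<^sup>+x. (\<Prod>i<n. \<integral>\<^sup>+b. f i (x i) b \<partial>std_gauss) \<partial>gauss n)"
      unfolding ind gauss_def by (intro nn_integral_cong pi_gauss.product_nn_integral_prod fm2) auto
    also have "\<dots> = (\<Prod>i<n. \<integral>\<^sup>+a. \<integral>\<^sup>+b. f i a b \<partial>std_gauss \<partial>std_gauss)"
      unfolding gauss_def by (intro pi_gauss.product_nn_integral_prod) (use fm3 in auto)
    also have "\<dots> = (\<Prod>i<n. emeasure (std_gauss \<Otimes>\<^sub>M std_gauss) (A i))"
      using A by (intro prod.cong refl) (simp add: f_def std_gauss.emeasure_pair_measure)
    finally show "emeasure (distr ?M ?P ?z) (Pi\<^sub>E {..<n} A) = (\<Prod>i\<in>{..<n}. emeasure (std_gauss \<Otimes>\<^sub>M std_gauss) (A i))" .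
  qed simp_all
qed

text \<open>The map is an orthogonal reflection of the plane, and the joint density depends only on
  \<open>x^2 + y^2\<close>. The change of variables is split into two affine substitutions on the
  line with an exchange of integrals between them; \<open>s > 0\<close> makes both solvable, and
  their Jacobians \<open>1/s\<close> and \<open>s\<close> cancel. A reflection is its own inverse,
  which later allows two points of the rotated path to be exchanged.\<close>

lemma std_gauss_reflect:
  assumes g[measurable]: "g \<in> borel_measurable (borel \<Otimes>\<^sub>M borel)"
    and cs: "c\<^sup>2 + s\<^sup>2 = (1::real)" and s: "s > 0"
  shows "(\<integral>\<^sup>+x. \<integral>\<^sup>+y. g (c * x + s * y, s * x - c * y) \<partial>std_gauss \<partial>std_gauss)
       = (\<integral>\<^sup>+x. \<integral>\<^sup>+y. g (x, y) \<partial>std_gauss \<partial>std_gauss)"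
proof -
  define p where "p x y = ennreal (std_normal_density x) * ennreal (std_normal_density y)" for x y
  have p_eq: "p x y = ennreal (1 / (2 * pi) * exp (- (x\<^sup>2 + y\<^sup>2) / 2))" for x y
  proof -
    have "std_normal_density x * std_normal_density y
      = (1 / sqrt (2 * pi))\<^sup>2 * (exp (- x\<^sup>2 / 2) * exp (- y\<^sup>2 / 2))"
      unfolding std_normal_density_def power2_eq_square by (simp only: mult_ac)
    also have "(1 / sqrt (2 * pi))\<^sup>2 = 1 / (2 * pi)"
      by (simp add: power_divide)
    also have "exp (- x\<^sup>2 / 2) * exp (- y\<^sup>2 / 2) = exp (- (x\<^sup>2 + y\<^sup>2) / 2)"
      unfolding exp_add[symmetric] by (simp add: field_simps)
    finally show ?thesis by (simp add: p_def ennreal_mult[symmetric])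
  qed
  have pm[measurable]: "(\<lambda>z. p (fst z) (snd z)) \<in> borel_measurable (borel \<Otimes>\<^sub>M borel)"
    unfolding p_def by measurable
  have dens: "(\<integral>\<^sup>+x. \<integral>\<^sup>+y. h (x, y) \<partial>std_gauss \<partial>std_gauss) = (\<integral>\<^sup>+x. \<integral>\<^sup>+y. p x y * h (x, y) \<partial>lborel \<partial>lborel)"
    if [measurable]: "h \<in> borel_measurable (borel \<Otimes>\<^sub>M borel)" for h
    by (simp add: nn_integral_density p_def nn_integral_cmult[symmetric] mult.assoc)
  have cs': "c * c + s * s = 1" using cs by (simp add: power2_eq_square)
  have "(\<integral>\<^sup>+x. \<integral>\<^sup>+y. g (c * x + s * y, s * x - c * y) \<partial>std_gauss \<partial>std_gauss)
     = (\<integral>\<^sup>+x. \<integral>\<^sup>+y. p x y * g (c * x + s * y, s * x - c * y) \<partial>lborel \<partial>lborel)"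
    using dens[of "\<lambda>z. g (c * fst z + s * snd z, s * fst z - c * snd z)"] by simp
  also have "\<dots> = (\<integral>\<^sup>+x. ennreal (1/s) * (\<integral>\<^sup>+u. p x (- (c/s) * x + (1/s) * u) * g (u, (x - c * u) / s) \<partial>lborel) \<partial>lborel)"
  proof (intro nn_integral_cong)
    \<comment> \<open>Substitution \<open>u = c * x + s * y\<close>; by \<open>c^2 + s^2 = 1\<close>
      the second coordinate becomes \<open>(x - c * u) / s\<close>.\<close>
    fix x :: real
    have "(\<integral>\<^sup>+y. p x y * g (c * x + s * y, s * x - c * y) \<partial>lborel)
      = ennreal \<bar>1/s\<bar> * (\<integral>\<^sup>+u. p x (- (c/s) * x + (1/s) * u) *
           g (c * x + s * (- (c/s) * x + (1/s) * u), s * x - c * (- (c/s) * x + (1/s) * u)) \<partial>lborel)"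
      unfolding p_def using s by (intro nn_integral_real_affine) auto
    moreover have "c * x + s * (- (c/s) * x + (1/s) * u) = u" for u
      using s by (simp add: field_simps)
    moreover have "s * x - c * (- (c/s) * x + (1/s) * u) = (x - c * u) / s" for u
    proof -
      have "s * x - c * (- (c/s) * x + (1/s) * u) = ((c * c + s * s) * x - c * u) / s"
        using s by (simp add: field_simps)
      then show ?thesis by (simp add: cs')
    qed
    ultimately show "(\<integral>\<^sup>+y. p x y * g (c * x + s * y, s * x - c * y) \<partial>lborel)
      = ennreal (1/s) * (\<integral>\<^sup>+u. p x (- (c/s) * x + (1/s) * u) * g (u, (x - c * u) / s) \<partial>lborel)"
      using s by simp
  qed
  also have "\<dots> = (\<integral>\<^sup>+x. \<integral>\<^sup>+u. ennreal (1/s) * (p x (- (c/s) * x + (1/s) * u) * g (u, (x - c * u) / s)) \<partial>lborel \<partial>lborel)"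
    unfolding p_def by (simp add: nn_integral_cmult)
  also have "\<dots> = (\<integral>\<^sup>+u. \<integral>\<^sup>+x. ennreal (1/s) * (p x (- (c/s) * x + (1/s) * u) * g (u, (x - c * u) / s)) \<partial>lborel \<partial>lborel)"
    unfolding p_def by (intro lborel_pair.Fubini') simp
  also have "\<dots> = (\<integral>\<^sup>+u. \<integral>\<^sup>+v. p u v * g (u, v) \<partial>lborel \<partial>lborel)"
  proof (rule nn_integral_cong)
    \<comment> \<open>Substitution \<open>x = c * u + s * v\<close>, which turns
      \<open>(x - c * u) / s\<close> into \<open>v\<close>.\<close>
    fix u :: real
    have "(\<integral>\<^sup>+x. ennreal (1/s) * (p x (- (c/s) * x + (1/s) * u) * g (u, (x - c * u) / s)) \<partial>lborel)
      = ennreal \<bar>s\<bar> * (\<integral>\<^sup>+v. ennreal (1/s) * (p (c * u + s * v) (- (c/s) * (c * u + s * v) + (1/s) * u) * g (u, (c * u + s * v - c * u) / s)) \<partial>lborel)"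
      unfolding p_def using s by (intro nn_integral_real_affine) auto
    also have "\<dots> = (\<integral>\<^sup>+v. ennreal s * (ennreal (1/s) * (p (c * u + s * v) (- (c/s) * (c * u + s * v) + (1/s) * u) * g (u, (c * u + s * v - c * u) / s))) \<partial>lborel)"
      unfolding p_def using s by (simp add: nn_integral_cmult)
    also have "\<dots> = (\<integral>\<^sup>+v. p u v * g (u, v) \<partial>lborel)"
    proof (intro nn_integral_cong)
      fix v :: real
      have 1: "- (c/s) * (c * u + s * v) + (1/s) * u = s * u - c * v"
      proof -
        have "- (c/s) * (c * u + s * v) + (1/s) * u = ((1 - c * c) * u - c * s * v) / s"
          using s by (simp add: field_simps)
        also have "1 - c * c = s * s" using cs' by simp
        finally show ?thesis using s by (simp add: field_simps)
      qed
      have "(c * u + s * v)\<^sup>2 + (s * u - c * v)\<^sup>2 = (c\<^sup>2 + s\<^sup>2) * (u\<^sup>2 + v\<^sup>2)"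
        by algebra
      then have 2: "p (c * u + s * v) (s * u - c * v) = p u v"
        by (simp add: p_eq cs)
      have 3: "ennreal s * (ennreal (1/s) * X) = X" for X
        using s by (simp add: mult.assoc[symmetric] ennreal_mult[symmetric])
      show "ennreal s * (ennreal (1/s) * (p (c * u + s * v) (- (c/s) * (c * u + s * v) + (1/s) * u) * g (u, (c * u + s * v - c * u) / s))) = p u v * g (u, v)"
        unfolding 1 2 3 using s by simp
    qed
    finally show "(\<integral>\<^sup>+x. ennreal (1/s) * (p x (- (c/s) * x + (1/s) * u) * g (u, (x - c * u) / s)) \<partial>lborel) = (\<integral>\<^sup>+v. p u v * g (u, v) \<partial>lborel)" .
  qed
  also have "\<dots> = (\<integral>\<^sup>+x. \<integral>\<^sup>+y. g (x, y) \<partial>std_gauss \<partial>std_gauss)"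
    using dens[of g] by simp
  finally show ?thesis .
qed

text \<open>Two vectors are regrouped into \<open>n\<close> independent planar pairs. The reflection
  acts on each pair separately, so the planar case gives invariance on boxes.\<close>

lemma gauss_pair_reflect:
  assumes g: "g \<in> borel_measurable (gauss n \<Otimes>\<^sub>M gauss n)"
    and cs: "c\<^sup>2 + s\<^sup>2 = (1::real)" and s: "s > 0"
  shows "(\<integral>\<^sup>+x. \<integral>\<^sup>+y. g (\<lambda>i\<in>{..<n}. c * x i + s * y i, \<lambda>i\<in>{..<n}. s * x i - c * y i) \<partial>gauss n \<partial>gauss n)
       = (\<integral>\<^sup>+x. \<integral>\<^sup>+y. g (x, y) \<partial>gauss n \<partial>gauss n)"
proof -
  interpret pr: pair_prob_space std_gauss std_gauss by unfold_locales
  interpret pp: product_prob_space "\<lambda>_::nat. std_gauss \<Otimes>\<^sub>M std_gauss" "{..<n}"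
    by unfold_locales
  let ?M = "gauss n \<Otimes>\<^sub>M gauss n"
  let ?P = "PiM {..<n} (\<lambda>_. std_gauss \<Otimes>\<^sub>M std_gauss)"
  \<comment> \<open>\<open>?z\<close> zips two vectors into a vector of pairs, \<open>u\<close>
    unzips it, and \<open>S\<close> reflects every pair.\<close>
  let ?z = "\<lambda>(x, y). \<lambda>i\<in>{..<n}. (x i :: real, y i :: real)"
  define u where "u w = (\<lambda>i\<in>{..<n}. fst (w i) :: real, \<lambda>i\<in>{..<n}. snd (w i) :: real)" for w
  define S where "S w = (\<lambda>i\<in>{..<n}. (c * fst (w i) + s * snd (w i), s * fst (w i) - c * snd (w i)))" for w
  have z[measurable]: "?z \<in> measurable ?M ?P" by measurable
  have u[measurable]: "u \<in> measurable ?P ?M" unfolding u_def by measurable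
  have S[measurable]: "S \<in> measurable ?P ?P" unfolding S_def by measurable
  have inv: "distr ?P ?P S = ?P"
  proof (rule pp.PiM_eqI)
    show "sets (distr ?P ?P S) = sets ?P" by simp
    fix A :: "nat \<Rightarrow> (real \<times> real) set"
    assume A: "\<And>i. i \<in> {..<n} \<Longrightarrow> A i \<in> sets (std_gauss \<Otimes>\<^sub>M std_gauss)"
    define f :: "nat \<Rightarrow> real \<times> real \<Rightarrow> ennreal"
      where "f i p = indicator (A i) (c * fst p + s * snd p, s * fst p - c * snd p)" for i p
    have fm: "f i \<in> borel_measurable (std_gauss \<Otimes>\<^sub>M std_gauss)" if "i < n" for i
    proof -
      have [measurable]: "A i \<in> sets (borel \<Otimes>\<^sub>M borel)" using A[of i] that by (simp cong: sets_pair_measure_cong)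
      show ?thesis unfolding f_def by measurable
    qed
    have B: "Pi\<^sub>E {..<n} A \<in> sets ?P"
      using A by (intro sets_PiM_I_finite) auto
    have ind: "indicator (Pi\<^sub>E {..<n} A) (S w) = (\<Prod>i<n. f i (w i))" for w
      by (auto simp: indicator_def f_def S_def PiE_iff prod_zero_iff)
    have 1: "(\<integral>\<^sup>+p. f i p \<partial>(std_gauss \<Otimes>\<^sub>M std_gauss)) = emeasure (std_gauss \<Otimes>\<^sub>M std_gauss) (A i)" if "i < n" for i
    proof -
      have Ai: "A i \<in> sets (borel \<Otimes>\<^sub>M borel)" using A[of i] that by (simp cong: sets_pair_measure_cong)
      have "(\<integral>\<^sup>+p. f i p \<partial>(std_gauss \<Otimes>\<^sub>M std_gauss)) = (\<integral>\<^sup>+x. \<integral>\<^sup>+y. f i (x, y) \<partial>std_gauss \<partial>std_gauss)"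
        by (rule std_gauss.nn_integral_fst[symmetric]) (rule fm[OF that])
      also have "\<dots> = (\<integral>\<^sup>+x. \<integral>\<^sup>+y. indicator (A i) (x, y) \<partial>std_gauss \<partial>std_gauss)"
        unfolding f_def fst_conv snd_conv by (rule std_gauss_reflect) (use Ai cs s in auto)
      also have "\<dots> = emeasure (std_gauss \<Otimes>\<^sub>M std_gauss) (A i)"
        using A that by (simp add: std_gauss.emeasure_pair_measure)
      finally show ?thesis .
    qed
    have "emeasure (distr ?P ?P S) (Pi\<^sub>E {..<n} A) = (\<integral>\<^sup>+w. indicator (Pi\<^sub>E {..<n} A) w \<partial>distr ?P ?P S)"
      using B by simp
    also have "\<dots> = (\<integral>\<^sup>+w. indicator (Pi\<^sub>E {..<n} A) (S w) \<partial>?P)"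
      using B by (intro nn_integral_distr) auto
    also have "\<dots> = (\<Prod>i<n. \<integral>\<^sup>+p. f i p \<partial>(std_gauss \<Otimes>\<^sub>M std_gauss))"
      unfolding ind by (intro pp.product_nn_integral_prod) (use fm in auto)
    also have "\<dots> = (\<Prod>i<n. emeasure (std_gauss \<Otimes>\<^sub>M std_gauss) (A i))"
      by (intro prod.cong refl 1) simp
    finally show "emeasure (distr ?P ?P S) (Pi\<^sub>E {..<n} A) = (\<Prod>i\<in>{..<n}. emeasure (std_gauss \<Otimes>\<^sub>M std_gauss) (A i))" .
  qed simp_all
  note g[measurable]
  have "(\<integral>\<^sup>+x. \<integral>\<^sup>+y. g (\<lambda>i\<in>{..<n}. c * x i + s * y i, \<lambda>i\<in>{..<n}. s * x i - c * y i) \<partial>gauss n \<partial>gauss n)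
    = (\<integral>\<^sup>+x. \<integral>\<^sup>+y. g (u (S (?z (x, y)))) \<partial>gauss n \<partial>gauss n)"
    by (intro nn_integral_cong arg_cong[where f=g]) (auto simp: u_def S_def fun_eq_iff)
  also have "\<dots> = (\<integral>\<^sup>+p. g (u (S (?z p))) \<partial>?M)"
    by (rule gauss.nn_integral_fst) measurable
  also have "\<dots> = (\<integral>\<^sup>+w. g (u (S w)) \<partial>distr ?M ?P ?z)"
    by (rule nn_integral_distr[symmetric]) measurable
  also have "\<dots> = (\<integral>\<^sup>+w. g (u w) \<partial>distr ?P ?P S)"
    unfolding distr_gauss_pair by (rule nn_integral_distr[symmetric]) measurable
  also have "\<dots> = (\<integral>\<^sup>+w. g (u w) \<partial>distr ?M ?P ?z)"
    unfolding inv distr_gauss_pair ..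
  also have "\<dots> = (\<integral>\<^sup>+p. g (u (?z p)) \<partial>?M)"
    by (rule nn_integral_distr) measurable
  also have "\<dots> = (\<integral>\<^sup>+x. \<integral>\<^sup>+y. g (u (?z (x, y))) \<partial>gauss n \<partial>gauss n)"
    by (rule gauss.nn_integral_fst[symmetric]) measurable
  also have "\<dots> = (\<integral>\<^sup>+x. \<integral>\<^sup>+y. g (x, y) \<partial>gauss n \<partial>gauss n)"
    by (intro nn_integral_cong arg_cong[where f=g])
       (auto simp: u_def fun_eq_iff space_gauss extensional_def)
  finally show ?thesis .
qed

section \<open>Gaussian change of measure under translations\<close>

lemma std_gauss_shift:
  assumes [measurable]: "f \<in> borel_measurable borel"
  shows "(\<integral>\<^sup>+y. f (y + a) \<partial>std_gauss) = (\<integral>\<^sup>+y. ennreal (exp (y * a - a * a / 2)) * f y \<partial>std_gauss)"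
proof -
  have e: "std_normal_density (y - a) = std_normal_density y * exp (y * a - a * a / 2)" for y
    by (simp add: std_normal_density_def mult_exp_exp power2_eq_square algebra_simps add_divide_distrib diff_divide_distrib)
  have "(\<integral>\<^sup>+y. f (y + a) \<partial>std_gauss) = (\<integral>\<^sup>+y. ennreal (std_normal_density y) * f (y + a) \<partial>lborel)"
    by (simp add: nn_integral_density)
  also have "\<dots> = (\<integral>\<^sup>+y. ennreal (std_normal_density (-a + 1 * y)) * f (-a + 1 * y + a) \<partial>lborel)"
    using nn_integral_real_affine[of "\<lambda>y. ennreal (std_normal_density y) * f (y + a)" 1 "-a"] by simp
  also have "\<dots> = (\<integral>\<^sup>+y. ennreal (std_normal_density y) * (ennreal (exp (y * a - a * a / 2)) * f y) \<partial>lborel)"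
    by (intro nn_integral_cong) (simp add: e ennreal_mult mult.assoc)
  also have "\<dots> = (\<integral>\<^sup>+y. ennreal (exp (y * a - a * a / 2)) * f y \<partial>std_gauss)"
    by (simp add: nn_integral_density)
  finally show ?thesis .
qed

text \<open>Cameron-Martin formula in finite dimension: the translated law and the reweighted law
  are both identified, by comparison on boxes, with the product of the shifted one-dimensional laws
  \<open>D i\<close>.\<close>

lemma gauss_shift:
  assumes f: "f \<in> borel_measurable (gauss n)"
  shows "(\<integral>\<^sup>+x. f (\<lambda>i\<in>{..<n}. x i + a i) \<partial>gauss n)
       = (\<integral>\<^sup>+x. ennreal (exp (ip n x a - ip n a a / 2)) * f x \<partial>gauss n)"
proof -
  let ?N = "PiM {..<n} (\<lambda>_. borel) :: (nat \<Rightarrow> real) measure"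
  define D where "D i = distr std_gauss borel (\<lambda>y. y + a i)" for i
  define S where "S x = (\<lambda>i\<in>{..<n}. x i + a i)" for x :: "nat \<Rightarrow> real"
  define k where "k i y = ennreal (exp (y * a i - a i * a i / 2))" for i y
  have kk: "ennreal (exp (ip n x a - ip n a a / 2)) = (\<Prod>i<n. k i (x i))" for x
    unfolding k_def ip_def by (simp add: prod_ennreal exp_sum[symmetric] sum_subtractf sum_divide_distrib)
  have pD: "prob_space (D i)" for i
    unfolding D_def by (rule std_gauss.prob_space_distr) simp
  interpret D: product_prob_space D "{..<n}"
    using pD by (simp add: product_prob_space_def product_prob_space_axioms_def product_sigma_finite_def prob_space_imp_sigma_finite)
  have sD: "sets (PiM {..<n} D) = sets ?N"
    by (rule sets_PiM_cong) (simp_all add: D_def)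
  have S[measurable]: "S \<in> measurable (gauss n) (gauss n)"
    unfolding S_def by measurable
  have km[measurable]: "k i \<in> borel_measurable borel" for i unfolding k_def by measurable
  have eD: "emeasure (D i) A = (\<integral>\<^sup>+y. indicator A (y + a i) \<partial>std_gauss)" if A[measurable]: "A \<in> sets borel" for i A
  proof -
    have "emeasure (D i) A = (\<integral>\<^sup>+y. indicator A y \<partial>D i)" using A by (simp add: D_def)
    also have "\<dots> = (\<integral>\<^sup>+y. indicator A (y + a i) \<partial>std_gauss)" unfolding D_def by (rule nn_integral_distr) simp_all
    finally show ?thesis .
  qed
  have d1: "distr (gauss n) (gauss n) S = PiM {..<n} D"
  proof (rule D.PiM_eqI)
    show "sets (distr (gauss n) (gauss n) S) = sets (PiM {..<n} D)" by (simp add: sD sets_gauss)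
    fix A :: "nat \<Rightarrow> real set"
    assume A: "\<And>i. i \<in> {..<n} \<Longrightarrow> A i \<in> sets (D i)"
    then have A': "\<And>i. i < n \<Longrightarrow> A i \<in> sets borel" by (simp add: D_def)
    have B: "Pi\<^sub>E {..<n} A \<in> sets (gauss n)"
      unfolding sets_gauss using A' by (intro sets_PiM_I_finite) auto
    have ind: "indicator (Pi\<^sub>E {..<n} A) (S x) = (\<Prod>i<n. indicator (A i) (x i + a i) :: ennreal)" for x
      by (auto simp: indicator_def S_def PiE_iff prod_zero_iff)
    have "emeasure (distr (gauss n) (gauss n) S) (Pi\<^sub>E {..<n} A) = (\<integral>\<^sup>+x. indicator (Pi\<^sub>E {..<n} A) x \<partial>distr (gauss n) (gauss n) S)"
      using B by simp
    also have "\<dots> = (\<integral>\<^sup>+x. indicator (Pi\<^sub>E {..<n} A) (S x) \<partial>gauss n)"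
      using B by (intro nn_integral_distr) auto
    also have "\<dots> = (\<Prod>i<n. \<integral>\<^sup>+y. indicator (A i) (y + a i) \<partial>std_gauss)"
      unfolding ind gauss_def using A' by (intro pi_gauss.product_nn_integral_prod) auto
    also have "\<dots> = (\<Prod>i<n. emeasure (D i) (A i))"
      using A' by (intro prod.cong refl) (simp add: eD)
    finally show "emeasure (distr (gauss n) (gauss n) S) (Pi\<^sub>E {..<n} A) = (\<Prod>i\<in>{..<n}. emeasure (D i) (A i))" .
  qed simp_all
  have d2: "density (gauss n) (\<lambda>x. \<Prod>i<n. k i (x i)) = PiM {..<n} D"
  proof (rule D.PiM_eqI)
    show "sets (density (gauss n) (\<lambda>x. \<Prod>i<n. k i (x i))) = sets (PiM {..<n} D)" by (simp add: sD sets_gauss)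
    fix A :: "nat \<Rightarrow> real set"
    assume A: "\<And>i. i \<in> {..<n} \<Longrightarrow> A i \<in> sets (D i)"
    then have A': "\<And>i. i < n \<Longrightarrow> A i \<in> sets borel" by (simp add: D_def)
    have B: "Pi\<^sub>E {..<n} A \<in> sets (gauss n)"
      unfolding sets_gauss using A' by (intro sets_PiM_I_finite) auto
    have ind: "(\<Prod>i<n. k i (x i)) * indicator (Pi\<^sub>E {..<n} A) x = (\<Prod>i<n. k i (x i) * indicator (A i) (x i))"
      if "x \<in> space (gauss n)" for x
      using that by (auto simp: indicator_def space_gauss PiE_iff prod_zero_iff)
    have "emeasure (density (gauss n) (\<lambda>x. \<Prod>i<n. k i (x i))) (Pi\<^sub>E {..<n} A)
        = (\<integral>\<^sup>+x. (\<Prod>i<n. k i (x i)) * indicator (Pi\<^sub>E {..<n} A) x \<partial>gauss n)"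
      using B by (intro emeasure_density) auto
    also have "\<dots> = (\<integral>\<^sup>+x. (\<Prod>i<n. k i (x i) * indicator (A i) (x i)) \<partial>gauss n)"
      by (intro nn_integral_cong ind)
    also have "\<dots> = (\<Prod>i<n. \<integral>\<^sup>+y. k i y * indicator (A i) y \<partial>std_gauss)"
      unfolding gauss_def using A' by (intro pi_gauss.product_nn_integral_prod) auto
    also have "\<dots> = (\<Prod>i<n. emeasure (D i) (A i))"
      using A' by (intro prod.cong refl) (simp add: eD std_gauss_shift k_def)
    finally show "emeasure (density (gauss n) (\<lambda>x. \<Prod>i<n. k i (x i))) (Pi\<^sub>E {..<n} A) = (\<Prod>i\<in>{..<n}. emeasure (D i) (A i))" .
  qed simp_all
  have "(\<integral>\<^sup>+x. f (S x) \<partial>gauss n) = (\<integral>\<^sup>+x. f x \<partial>distr (gauss n) (gauss n) S)"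
    using f by (intro nn_integral_distr[symmetric]) auto
  also have "\<dots> = (\<integral>\<^sup>+x. f x \<partial>density (gauss n) (\<lambda>x. \<Prod>i<n. k i (x i)))"
    unfolding d1 d2 ..
  also have "\<dots> = (\<integral>\<^sup>+x. (\<Prod>i<n. k i (x i)) * f x \<partial>gauss n)"
    using f by (intro nn_integral_density) auto
  finally show ?thesis unfolding kk S_def .
qed

text \<open>Points of \<open>gauss n\<close> are \<open>undefined\<close> off \<open>{..<n}\<close>,
  while \<open>f\<close> lives on all sequences. As \<open>edist\<close> ignores those coordinates,
  resetting them to 0 by \<open>e\<close> does not change \<open>f\<close>; on the full sequence
  space \<open>f\<close> is continuous for the product topology, whose Borel sets are those of the
  product measure space.\<close>

lemma edist_lipschitz_measurable:
  fixes f :: "(nat \<Rightarrow> real) \<Rightarrow> real"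
  assumes L: "\<And>x y. \<bar>f x - f y\<bar> \<le> L * edist n x y"
  shows "f \<in> borel_measurable (gauss n)"
proof -
  define e where "e x = (\<lambda>i. if i < n then x i else 0)" for x :: "nat \<Rightarrow> real"
  have e: "e \<in> measurable (gauss n) (PiM UNIV (\<lambda>_. borel))"
    unfolding e_def
  proof (rule measurable_PiM_single', goal_cases)
    case (1 i)
    then show ?case by (cases "i < n") simp_all
  qed auto
  have fe: "f (e x) = f x" for x
    using L[of "e x" x] by (simp add: edist_def e_def)
  have "isCont f x" for x
  proof -
    have "isCont (\<lambda>y::nat \<Rightarrow> real. y i) x" for i
      using continuous_on_product_coordinates[of i, where ?'b = real]
      unfolding continuous_on_eq_continuous_at[OF open_UNIV] by blast
    then have "((\<lambda>y. L * edist n y x) \<longlongrightarrow> L * edist n x x) (at x)"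
      unfolding edist_def isCont_def by (intro tendsto_intros)
    then have "((\<lambda>y. L * edist n y x) \<longlongrightarrow> 0) (at x)" by (simp add: edist_def)
    then have "((\<lambda>y. f y - f x) \<longlongrightarrow> 0) (at x)"
      by (rule Lim_null_comparison[rotated]) (simp add: L)
    then show ?thesis by (simp add: isCont_def LIM_zero_iff)
  qed
  then have "continuous_on UNIV f" by (simp add: continuous_on_eq_continuous_at)
  then have "f \<in> borel_measurable borel" by (rule borel_measurable_continuous_onI)
  then have "f \<in> borel_measurable (PiM UNIV (\<lambda>_. borel))"
    using measurable_cong_sets[OF sets_PiM_equal_borel refl] by blast
  from measurable_compose[OF e this] show ?thesis by (simp add: fe)
qed

section \<open>Euclidean norm, and square integrability under the Gaussian measure\<close>

abbreviation enorm :: "nat \<Rightarrow> (nat \<Rightarrow> real) \<Rightarrow> real" where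
  "enorm n v \<equiv> L2_set v {..<n}"

lemma edist_enorm: "edist n u v = enorm n (\<lambda>i. u i - v i)"
  by (simp add: edist_def L2_set_def)

lemma edist_nonneg [simp]: "0 \<le> edist n u v"
  by (simp add: edist_enorm)

lemma edist_self [simp]: "edist n u u = 0"
  by (simp add: edist_def)

lemma edist_commute: "edist n u v = edist n v u"
  by (simp add: edist_def power2_commute)

lemma edist_triangle: "edist n u w \<le> edist n u v + edist n v w"
  using L2_set_triangle_ineq[of "\<lambda>i. u i - v i" "\<lambda>i. v i - w i" "{..<n}"] by (simp add: edist_enorm)

lemma ip_self: "ip n v v = (enorm n v)\<^sup>2"
  by (simp add: ip_def L2_set_def power2_eq_square sum_nonneg)

lemma edist_sq: "(edist n u v)\<^sup>2 = ip n (\<lambda>i. u i - v i) (\<lambda>i. u i - v i)"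
  by (simp add: ip_self edist_enorm)

lemma ip_cauchy_schwarz: "\<bar>ip n u v\<bar> \<le> enorm n u * enorm n v"
proof -
  have "\<bar>ip n u v\<bar> \<le> (\<Sum>i<n. \<bar>u i\<bar> * \<bar>v i\<bar>)"
    unfolding ip_def abs_mult[symmetric] by (rule sum_abs)
  also have "\<dots> \<le> enorm n u * enorm n v" by (rule L2_set_mult_ineq)
  finally show ?thesis .
qed

lemma enorm_measurable [measurable]: "enorm n \<in> borel_measurable (gauss n)"
  unfolding L2_set_def by measurable

lemma ip_measurable [measurable]: "(\<lambda>x. ip n x v) \<in> borel_measurable (gauss n)"
  unfolding ip_def by measurable

lemma gauss_enorm_sq:
  shows "integrable (gauss n) (\<lambda>x. (enorm n x)\<^sup>2)" "(\<integral>x. (enorm n x)\<^sup>2 \<partial>gauss n) = n"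
  using gauss_sq[of n] by (simp_all add: ip_self)

lemma gauss_square_integrable_imp_integrable:
  fixes f :: "(nat \<Rightarrow> real) \<Rightarrow> real"
  assumes "f \<in> borel_measurable (gauss n)" "integrable (gauss n) (\<lambda>x. (f x)\<^sup>2)"
  shows "integrable (gauss n) f"
  using gauss.square_integrable_imp_integrable assms by blast

lemma gauss_lipschitz_square_integrable:
  fixes f :: "(nat \<Rightarrow> real) \<Rightarrow> real"
  assumes L: "\<And>x y. \<bar>f x - f y\<bar> \<le> L * edist n x y"
  shows "integrable (gauss n) (\<lambda>x. (f x)\<^sup>2)"
proof (rule Bochner_Integration.integrable_bound)
  show "integrable (gauss n) (\<lambda>x. 2 * (f (\<lambda>_. 0))\<^sup>2 + 2 * L\<^sup>2 * (enorm n x)\<^sup>2)"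
    using gauss_enorm_sq by simp
  show "(\<lambda>x. (f x)\<^sup>2) \<in> borel_measurable (gauss n)"
    using edist_lipschitz_measurable[OF L] by measurable
  have "(f x)\<^sup>2 \<le> 2 * (f (\<lambda>_. 0))\<^sup>2 + 2 * L\<^sup>2 * (enorm n x)\<^sup>2" for x
  proof -
    let ?z = "f (\<lambda>_. 0)"
    have "(f x - ?z)\<^sup>2 \<le> (L * enorm n x)\<^sup>2"
      using power_mono[OF L[of x "\<lambda>_. 0"] abs_ge_zero, of 2] by (simp add: edist_enorm)
    moreover have "(f x)\<^sup>2 \<le> 2 * ?z\<^sup>2 + 2 * (f x - ?z)\<^sup>2"
      using zero_le_power2[of "f x - 2 * ?z"] by (simp add: power2_eq_square algebra_simps)
    ultimately show ?thesis by (simp add: power_mult_distrib)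
  qed
  then show "AE x in gauss n. norm ((f x)\<^sup>2) \<le> norm (2 * (f (\<lambda>_. 0))\<^sup>2 + 2 * L\<^sup>2 * (enorm n x)\<^sup>2)"
    by (auto intro: order_trans[OF _ abs_ge_self])
qed

lemma gauss_second_moment_about:
  fixes f :: "(nat \<Rightarrow> real) \<Rightarrow> real"
  assumes "f \<in> borel_measurable (gauss n)" "integrable (gauss n) (\<lambda>x. (f x)\<^sup>2)"
  shows "integrable (gauss n) (\<lambda>x. (f x - a)\<^sup>2)"
    and "(\<integral>x. (f x - a)\<^sup>2 \<partial>gauss n) = (\<integral>x. (f x)\<^sup>2 \<partial>gauss n) - 2 * a * (\<integral>x. f x \<partial>gauss n) + a\<^sup>2"
proof -
  note i = gauss_square_integrable_imp_integrable[OF assms] assms(2)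
  have e: "(f x - a)\<^sup>2 = (f x)\<^sup>2 - 2 * a * f x + a\<^sup>2" for x
    by (simp add: power2_diff algebra_simps)
  show "integrable (gauss n) (\<lambda>x. (f x - a)\<^sup>2)" unfolding e using i by simp
  show "(\<integral>x. (f x - a)\<^sup>2 \<partial>gauss n) = (\<integral>x. (f x)\<^sup>2 \<partial>gauss n) - 2 * a * (\<integral>x. f x \<partial>gauss n) + a\<^sup>2"
    unfolding e using i by (simp add: gauss.prob_space)
qed

section \<open>A variance bound for suprema of linear functionals\<close>

text \<open>Only an approximate subgradient at each point is required, so that neither a supremum has to be
attained nor the subgradient has to depend measurably on the point.\<close>

locale gauss_subgradient =
  fixes n :: nat and f :: "(nat \<Rightarrow> real) \<Rightarrow> real" and \<epsilon> :: real
  assumes subgradient: "\<And>x \<eta>. \<eta> > 0 \<Longrightarrow>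
      \<exists>t. enorm n t \<le> \<epsilon> \<and> (\<forall>y. f y \<ge> f x + ip n t (\<lambda>i. y i - x i) - \<eta>)"
begin

text \<open>Cauchy-Schwarz for an approximate subgradient at \<open>x\<close> bounds
  \<open>f x - f y\<close>; exchanging the points gives the absolute value. Measurability of
  \<open>f\<close>, and its independence of coordinates from \<open>n\<close> on, both rest on
  this.\<close>

lemma lipschitz: "\<bar>f x - f y\<bar> \<le> \<epsilon> * edist n x y"
proof -
  have "f x - f y \<le> \<epsilon> * edist n x y" for x y
  proof (rule field_le_epsilon)
    fix \<eta> :: real assume "\<eta> > 0"
    then obtain t where t: "enorm n t \<le> \<epsilon>" "f y \<ge> f x + ip n t (\<lambda>i. y i - x i) - \<eta>"
      using subgradient by blast
    have "- ip n t (\<lambda>i. y i - x i) \<le> enorm n t * edist n y x"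
      using ip_cauchy_schwarz[of n t "\<lambda>i. y i - x i"] by (simp add: edist_enorm)
    also have "\<dots> \<le> \<epsilon> * edist n x y"
      using t(1) by (simp add: edist_commute mult_right_mono)
    finally show "f x - f y \<le> \<epsilon> * edist n x y + \<eta>" using t(2) by simp
  qed
  from this[of x y] this[of y x] show ?thesis by (simp add: edist_commute abs_le_iff)
qed

lemma measurable_f [measurable]: "f \<in> borel_measurable (gauss n)"
  using lipschitz by (rule edist_lipschitz_measurable)

lemma square_integrable: "integrable (gauss n) (\<lambda>x. (f x)\<^sup>2)"
  using lipschitz by (rule gauss_lipschitz_square_integrable)

lemma integrable_f: "integrable (gauss n) f"
  using measurable_f square_integrable by (rule gauss_square_integrable_imp_integrable)

lemma f_cong:
  assumes "\<And>i. i < n \<Longrightarrow> x i = y i" shows "f x = f y"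
  using lipschitz[of x y] assms by (simp add: edist_def)

definition rot :: "real \<Rightarrow> (nat \<Rightarrow> real) \<Rightarrow> (nat \<Rightarrow> real) \<Rightarrow> nat \<Rightarrow> real" where
  "rot \<theta> x y = (\<lambda>i\<in>{..<n}. cos \<theta> * x i + sin \<theta> * y i)"

text \<open>The sign of the cosine term makes \<open>rot\<close> and \<open>rot_refl\<close>
  together the reflection of \<open>gauss_pair_reflect\<close> instead of a rotation.\<close>

definition rot_refl :: "real \<Rightarrow> (nat \<Rightarrow> real) \<Rightarrow> (nat \<Rightarrow> real) \<Rightarrow> nat \<Rightarrow> real" where
  "rot_refl \<theta> x y = (\<lambda>i\<in>{..<n}. sin \<theta> * x i - cos \<theta> * y i)"

definition energy :: "real \<Rightarrow> ennreal" where
  "energy \<theta> = (\<integral>\<^sup>+x. \<integral>\<^sup>+y. ennreal ((f (rot \<theta> x y) - f x)\<^sup>2) \<partial>gauss n \<partial>gauss n)"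

lemma rot_measurable [measurable]:
  "(\<lambda>(x, y). rot \<theta> x y) \<in> measurable (gauss n \<Otimes>\<^sub>M gauss n) (gauss n)"
  unfolding rot_def by measurable

text \<open>The reflected pair runs through the path backwards from angle \<open>\<phi>\<close>, by
  the subtraction formulas for cosine and sine. For \<open>\<psi> = \<phi>\<close> it ends at
  \<open>x\<close>.\<close>

lemma f_rot_reflect: "f (rot \<psi> (rot \<phi> x y) (rot_refl \<phi> x y)) = f (rot (\<phi> - \<psi>) x y)"
  by (rule f_cong) (simp add: rot_def rot_refl_def cos_diff sin_diff algebra_simps)

lemma f_rot_0: "f (rot 0 x y) = f x"
  by (rule f_cong) (simp add: rot_def)

lemma reflect:
  assumes "g \<in> borel_measurable (gauss n \<Otimes>\<^sub>M gauss n)" "sin \<phi> > 0"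
  shows "(\<integral>\<^sup>+x. \<integral>\<^sup>+y. g (rot \<phi> x y, rot_refl \<phi> x y) \<partial>gauss n \<partial>gauss n)
       = (\<integral>\<^sup>+x. \<integral>\<^sup>+y. g (x, y) \<partial>gauss n \<partial>gauss n)"
  unfolding rot_def rot_refl_def using assms by (intro gauss_pair_reflect) simp_all

text \<open>With \<open>X\<^sub>\<theta> = X cos \<theta> + Y sin \<theta>\<close> for independent Gaussian \<open>X\<close>, \<open>Y\<close>, \<open>energy \<theta>\<close> is the second moment
of \<open>f(X\<^sub>\<theta>) - f(X\<^sub>0)\<close>, and \<open>energy (\<pi>/2)\<close> is twice the variance. Halving the angle costs a factor \<open>4\<close>,
while for small \<open>\<theta>\<close> the energy is of order \<open>\<theta>\<^sup>2 \<epsilon>\<^sup>2\<close> up to a dimension-dependent \<open>O(\<theta>\<^sup>4)\<close> that vanishes in the limit.\<close>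

lemma energy_double:
  assumes "sin (2 * \<theta>) > 0"
  shows "energy (2 * \<theta>) \<le> 4 * energy \<theta>"
proof -
  \<comment> \<open>Reflection with angle \<open>2 * \<theta>\<close> keeps the midpoint of the arc
    and sends its start to its end, so both halves have the same energy. The factor 4 then comes
    from the inequality for \<open>(u - w)^2\<close> applied to two equal halves.\<close>
  have 1: "(\<integral>\<^sup>+x. \<integral>\<^sup>+y. ennreal ((f (rot (2 * \<theta>) x y) - f (rot \<theta> x y))\<^sup>2) \<partial>gauss n \<partial>gauss n) = energy \<theta>"
  proof -
    have "energy \<theta> = (\<integral>\<^sup>+x. \<integral>\<^sup>+y. ennreal ((f (rot \<theta> (rot (2 * \<theta>) x y) (rot_refl (2 * \<theta>) x y)) - f (rot (2 * \<theta>) x y))\<^sup>2) \<partial>gauss n \<partial>gauss n)"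
      using reflect[of "\<lambda>(x, y). ennreal ((f (rot \<theta> x y) - f x)\<^sup>2)", OF _ assms] by (simp add: energy_def)
    then show ?thesis by (simp add: f_rot_reflect power2_commute)
  qed
  have "energy (2 * \<theta>) \<le> (\<integral>\<^sup>+x. \<integral>\<^sup>+y. 2 * ennreal ((f (rot (2 * \<theta>) x y) - f (rot \<theta> x y))\<^sup>2)
      + 2 * ennreal ((f (rot \<theta> x y) - f x)\<^sup>2) \<partial>gauss n \<partial>gauss n)"
    unfolding energy_def
  proof (intro nn_integral_mono)
    fix x y
    have *: "(u - w)\<^sup>2 \<le> 2 * (u - v)\<^sup>2 + 2 * (v - w)\<^sup>2" for u v w :: real
      using zero_le_power2[of "(u - v) - (v - w)"] by (simp add: power2_eq_square algebra_simps)
    then show "ennreal ((f (rot (2 * \<theta>) x y) - f x)\<^sup>2) \<le> 2 * ennreal ((f (rot (2 * \<theta>) x y) - f (rot \<theta> x y))\<^sup>2)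
      + 2 * ennreal ((f (rot \<theta> x y) - f x)\<^sup>2)"
      by (auto simp: ennreal_plus[symmetric] ennreal_mult'[symmetric] ennreal_numeral[symmetric]
           simp del: ennreal_plus ennreal_numeral intro!: ennreal_leI)
  qed
  also have "\<dots> = (\<integral>\<^sup>+x. 2 * (\<integral>\<^sup>+y. ennreal ((f (rot (2 * \<theta>) x y) - f (rot \<theta> x y))\<^sup>2) \<partial>gauss n)
      + 2 * (\<integral>\<^sup>+y. ennreal ((f (rot \<theta> x y) - f x)\<^sup>2) \<partial>gauss n) \<partial>gauss n)"
    by (intro nn_integral_cong) (simp add: nn_integral_add nn_integral_cmult)
  also have "\<dots> = 2 * energy \<theta> + 2 * energy \<theta>"
    unfolding 1[symmetric]
    by (subst nn_integral_add, measurable)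
       (simp add: nn_integral_cmult energy_def 1[unfolded energy_def])
  also have "\<dots> = 4 * energy \<theta>" by (simp flip: distrib_right)
  finally show ?thesis .
qed

text \<open>A subgradient at \<open>X\<^sub>0\<close> bounds \<open>f(X\<^sub>\<theta>) - f(X\<^sub>0)\<close> from below only; exchangeability of
\<open>(X\<^sub>0, X\<^sub>\<theta>)\<close> supplies the other sign.\<close>

lemma energy_neg_part:
  assumes "sin \<theta> > 0"
  shows "energy \<theta> = 2 * (\<integral>\<^sup>+x. \<integral>\<^sup>+y. ennreal ((max 0 (f x - f (rot \<theta> x y)))\<^sup>2) \<partial>gauss n \<partial>gauss n)"
proof -
  let ?N = "\<integral>\<^sup>+x. \<integral>\<^sup>+y. ennreal ((max 0 (f x - f (rot \<theta> x y)))\<^sup>2) \<partial>gauss n \<partial>gauss n"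
  \<comment> \<open>Reflection with the angle \<open>\<theta>\<close> itself swaps the two points,
    so the positive and the negative part of the increment have equal second moments.\<close>
  have 1: "(\<integral>\<^sup>+x. \<integral>\<^sup>+y. ennreal ((max 0 (f (rot \<theta> x y) - f x))\<^sup>2) \<partial>gauss n \<partial>gauss n) = ?N"
    using reflect[of "\<lambda>(x, y). ennreal ((max 0 (f x - f (rot \<theta> x y)))\<^sup>2)", OF _ assms]
    by (simp add: f_rot_reflect f_rot_0)
  have "energy \<theta> = (\<integral>\<^sup>+x. \<integral>\<^sup>+y. ennreal ((max 0 (f (rot \<theta> x y) - f x))\<^sup>2)
      + ennreal ((max 0 (f x - f (rot \<theta> x y)))\<^sup>2) \<partial>gauss n \<partial>gauss n)"
    unfolding energy_def
    by (intro nn_integral_cong) (auto simp: max_def power2_commute)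
  also have "\<dots> = (\<integral>\<^sup>+x. (\<integral>\<^sup>+y. ennreal ((max 0 (f (rot \<theta> x y) - f x))\<^sup>2) \<partial>gauss n)
      + (\<integral>\<^sup>+y. ennreal ((max 0 (f x - f (rot \<theta> x y)))\<^sup>2) \<partial>gauss n) \<partial>gauss n)"
    by (intro nn_integral_cong) (simp add: nn_integral_add)
  also have "\<dots> = ?N + ?N"
    by (subst nn_integral_add, measurable) (simp add: 1)
  finally show ?thesis by (simp add: mult_2)
qed

text \<open>The argument moves by \<open>sin \<theta> * y - (1 - cos \<theta>) * x\<close>. A
  subgradient chosen at \<open>x\<close> does not depend on \<open>y\<close>, so its pairing with
  \<open>y\<close> has mean square at most \<open>\<epsilon>^2\<close>, without a factor of the
  dimension. The pairing with \<open>x\<close> costs \<open>enorm n x\<close> by Cauchy-Schwarz, but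
  its coefficient is only of order \<open>\<theta>^2\<close>. The 3 comes from squaring a sum of
  three terms.\<close>

lemma inner_neg_part:
  "(\<integral>\<^sup>+y. ennreal ((max 0 (f x - f (rot \<theta> x y)))\<^sup>2) \<partial>gauss n)
    \<le> ennreal (3 * (sin \<theta>)\<^sup>2 * \<epsilon>\<^sup>2 + 3 * (1 - cos \<theta>)\<^sup>2 * \<epsilon>\<^sup>2 * (enorm n x)\<^sup>2)" (is "?I \<le> ennreal ?B")
proof -
  have "?I \<le> ennreal ?B + ennreal \<kappa>" if \<kappa>: "\<kappa> > 0" for \<kappa> :: real
  proof -
    \<comment> \<open>Chosen so that three times the squared subgradient error is exactly the slack
      \<open>\<kappa>\<close>.\<close>
    define \<eta> where "\<eta> = sqrt (\<kappa> / 3)"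
    have \<eta>: "\<eta> > 0" "3 * \<eta>\<^sup>2 = \<kappa>" using \<kappa> by (simp_all add: \<eta>_def)
    obtain t where t: "enorm n t \<le> \<epsilon>" "\<And>y. f y \<ge> f x + ip n t (\<lambda>i. y i - x i) - \<eta>"
      using subgradient[OF \<eta>(1)] by blast
    have b: "(max 0 (f x - f (rot \<theta> x y)))\<^sup>2 \<le> 3 * (sin \<theta>)\<^sup>2 * (ip n y t * ip n y t) + 3 * (1 - cos \<theta>)\<^sup>2 * \<epsilon>\<^sup>2 * (enorm n x)\<^sup>2 + \<kappa>" for y
    proof -
      let ?a = "sin \<theta> * ip n y t" and ?b = "(1 - cos \<theta>) * ip n t x"
      have "ip n t (\<lambda>i. rot \<theta> x y i - x i) = ?a - ?b"
        by (simp add: ip_def rot_def sum_distrib_left algebra_simps sum.distrib sum_subtractf)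
      then have "f x - f (rot \<theta> x y) \<le> - ?a + ?b + \<eta>" using t(2)[of "rot \<theta> x y"] by simp
      then have "max 0 (f x - f (rot \<theta> x y)) \<le> \<bar>- ?a + ?b + \<eta>\<bar>" by simp
      then have "(max 0 (f x - f (rot \<theta> x y)))\<^sup>2 \<le> (- ?a + ?b + \<eta>)\<^sup>2"
        by (metis max.cobounded1 power2_abs power_mono)
      also have "\<dots> \<le> 3 * ?a\<^sup>2 + 3 * ?b\<^sup>2 + 3 * \<eta>\<^sup>2"
        using zero_le_power2[of "?a + ?b"] zero_le_power2[of "?a + \<eta>"] zero_le_power2[of "?b - \<eta>"]
        by (simp only: power2_eq_square) (simp add: algebra_simps)
      also have "?b\<^sup>2 \<le> ((1 - cos \<theta>) * (\<epsilon> * enorm n x))\<^sup>2"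
      proof -
        have "\<bar>ip n t x\<bar> \<le> \<epsilon> * enorm n x"
          using ip_cauchy_schwarz[of n t x] mult_right_mono[OF t(1), of "enorm n x"] by simp
        then have "(ip n t x)\<^sup>2 \<le> (\<epsilon> * enorm n x)\<^sup>2"
          by (metis abs_ge_zero power2_abs power_mono)
        then show ?thesis by (simp add: power_mult_distrib mult_left_mono)
      qed
      finally show ?thesis using \<eta>(2) by (simp add: power_mult_distrib power2_eq_square mult_ac)
    qed
    have int: "integrable (gauss n) (\<lambda>y. 3 * (sin \<theta>)\<^sup>2 * (ip n y t * ip n y t) + 3 * (1 - cos \<theta>)\<^sup>2 * \<epsilon>\<^sup>2 * (enorm n x)\<^sup>2 + \<kappa>)"
      using gauss_ip_mult(1) by simp
    have "?I \<le> (\<integral>\<^sup>+y. ennreal (3 * (sin \<theta>)\<^sup>2 * (ip n y t * ip n y t) + 3 * (1 - cos \<theta>)\<^sup>2 * \<epsilon>\<^sup>2 * (enorm n x)\<^sup>2 + \<kappa>) \<partial>gauss n)"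
      by (intro nn_integral_mono ennreal_leI b)
    also have "\<dots> = ennreal (\<integral>y. 3 * (sin \<theta>)\<^sup>2 * (ip n y t * ip n y t) + 3 * (1 - cos \<theta>)\<^sup>2 * \<epsilon>\<^sup>2 * (enorm n x)\<^sup>2 + \<kappa> \<partial>gauss n)"
      using \<kappa> by (intro nn_integral_eq_integral int) auto
    also have "(\<integral>y. 3 * (sin \<theta>)\<^sup>2 * (ip n y t * ip n y t) + 3 * (1 - cos \<theta>)\<^sup>2 * \<epsilon>\<^sup>2 * (enorm n x)\<^sup>2 + \<kappa> \<partial>gauss n)
       = 3 * (sin \<theta>)\<^sup>2 * ip n t t + 3 * (1 - cos \<theta>)\<^sup>2 * \<epsilon>\<^sup>2 * (enorm n x)\<^sup>2 + \<kappa>"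
      using gauss_ip_mult[of n t t] by (simp add: gauss.prob_space)
    also have "\<dots> \<le> ?B + \<kappa>"
      using t(1) by (auto simp: ip_self intro!: mult_left_mono power_mono)
    finally show ?thesis using \<kappa> by (auto simp: ennreal_plus[symmetric] simp del: ennreal_plus elim!: order_trans intro!: ennreal_leI)
  qed
  then show ?thesis by (rule ennreal_le_epsilon)
qed

lemma energy_bound:
  assumes "sin \<theta> > 0"
  shows "energy \<theta> \<le> ennreal (6 * \<epsilon>\<^sup>2 * ((sin \<theta>)\<^sup>2 + (1 - cos \<theta>)\<^sup>2 * n))"
proof -
  have "energy \<theta> \<le> 2 * (\<integral>\<^sup>+x. ennreal (3 * (sin \<theta>)\<^sup>2 * \<epsilon>\<^sup>2 + 3 * (1 - cos \<theta>)\<^sup>2 * \<epsilon>\<^sup>2 * (enorm n x)\<^sup>2) \<partial>gauss n)"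
    unfolding energy_neg_part[OF assms] by (intro mult_left_mono nn_integral_mono inner_neg_part) auto
  also have "(\<integral>\<^sup>+x. ennreal (3 * (sin \<theta>)\<^sup>2 * \<epsilon>\<^sup>2 + 3 * (1 - cos \<theta>)\<^sup>2 * \<epsilon>\<^sup>2 * (enorm n x)\<^sup>2) \<partial>gauss n)
    = ennreal (\<integral>x. 3 * (sin \<theta>)\<^sup>2 * \<epsilon>\<^sup>2 + 3 * (1 - cos \<theta>)\<^sup>2 * \<epsilon>\<^sup>2 * (enorm n x)\<^sup>2 \<partial>gauss n)"
    using gauss_enorm_sq(1) by (intro nn_integral_eq_integral) auto
  also have "(\<integral>x. 3 * (sin \<theta>)\<^sup>2 * \<epsilon>\<^sup>2 + 3 * (1 - cos \<theta>)\<^sup>2 * \<epsilon>\<^sup>2 * (enorm n x)\<^sup>2 \<partial>gauss n)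
    = 3 * (sin \<theta>)\<^sup>2 * \<epsilon>\<^sup>2 + 3 * (1 - cos \<theta>)\<^sup>2 * \<epsilon>\<^sup>2 * n"
    using gauss_enorm_sq by (simp add: gauss.prob_space)
  also have "2 * ennreal (3 * (sin \<theta>)\<^sup>2 * \<epsilon>\<^sup>2 + 3 * (1 - cos \<theta>)\<^sup>2 * \<epsilon>\<^sup>2 * n)
     = ennreal (2 * (3 * (sin \<theta>)\<^sup>2 * \<epsilon>\<^sup>2 + 3 * (1 - cos \<theta>)\<^sup>2 * \<epsilon>\<^sup>2 * n))"
    by (subst ennreal_mult) auto
  also have "2 * (3 * (sin \<theta>)\<^sup>2 * \<epsilon>\<^sup>2 + 3 * (1 - cos \<theta>)\<^sup>2 * \<epsilon>\<^sup>2 * n) = 6 * \<epsilon>\<^sup>2 * ((sin \<theta>)\<^sup>2 + (1 - cos \<theta>)\<^sup>2 * n)"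
    by (simp add: algebra_simps)
  finally show ?thesis .
qed

text \<open>After \<open>k\<close> halvings the factor \<open>4 ^ k\<close> offsets the square of
  the angle. The dimension multiplies a fourth power of the angle, so it keeps a factor
  \<open>1 / 4 ^ k\<close>. The 24 is the 6 of \<open>energy_bound\<close> times 4, a crude bound
  for the square of \<open>pi / 2\<close>.\<close>

lemma energy_quarter_turn: "energy (pi / 2) \<le> ennreal (24 * \<epsilon>\<^sup>2 * (1 + n / 4 ^ k))"
proof -
  have iter: "energy (pi / 2) \<le> 4 ^ k * energy (pi / 2 / 2 ^ k)" for k
  proof (induction k)
    case (Suc k)
    have "1 \<le> (2::real) ^ k" by simp
    then have "1 < 2 * (2::real) ^ k" by linarith
    then have "pi / 2 / 2 ^ k < pi" by (simp add: field_simps)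
    then have "sin (2 * (pi / 2 / 2 ^ Suc k)) > 0"
      by (intro sin_gt_zero) simp_all
    from energy_double[OF this] have "energy (pi / 2 / 2 ^ k) \<le> 4 * energy (pi / 2 / 2 ^ Suc k)" by simp
    then have "4 ^ k * energy (pi / 2 / 2 ^ k) \<le> 4 ^ k * (4 * energy (pi / 2 / 2 ^ Suc k))"
      by (intro mult_left_mono) auto
    with Suc show ?case by (simp add: mult_ac)
  qed simp
  define \<delta> where "\<delta> = pi / 2 / 2 ^ k"
  have pos: "0 < \<delta>" by (simp add: \<delta>_def)
  have d4: "4 ^ k * \<delta>\<^sup>2 \<le> 4"
  proof -
    have "4 ^ k * \<delta>\<^sup>2 = (pi / 2)\<^sup>2"
      by (simp add: \<delta>_def power_divide power_mult[symmetric] mult.commute[of k] power_mult)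
    also have "\<dots> \<le> 2\<^sup>2" using pi_less_4 by (intro power_mono) auto
    finally show ?thesis by simp
  qed
  have "\<delta> \<le> pi / 2" by (simp add: \<delta>_def field_simps)
  then have "\<delta> < pi" using pi_gt_zero by linarith
  with pos have sp: "sin \<delta> > 0" by (rule sin_gt_zero)
  have s: "(sin \<delta>)\<^sup>2 \<le> \<delta>\<^sup>2" using sp sin_x_le_x[of \<delta>] pos by (intro power_mono) auto
  have "1 - cos \<delta> = 2 * (sin (\<delta> / 2))\<^sup>2" using cos_double_sin[of "\<delta> / 2"] by simp
  also have "\<dots> \<le> 2 * (\<delta> / 2)\<^sup>2"
    using abs_sin_x_le_abs_x[of "\<delta> / 2"] unfolding abs_le_square_iff by (rule mult_left_mono) simp
  finally have "1 - cos \<delta> \<le> \<delta>\<^sup>2 / 2" by (simp add: power_divide)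
  then have c: "(1 - cos \<delta>)\<^sup>2 \<le> (\<delta>\<^sup>2 / 2)\<^sup>2" by (intro power_mono) auto
  have "4 ^ k * ((sin \<delta>)\<^sup>2 + (1 - cos \<delta>)\<^sup>2 * n) \<le> 4 ^ k * (\<delta>\<^sup>2 + (\<delta>\<^sup>2 / 2)\<^sup>2 * n)"
    using s c by (intro mult_left_mono add_mono mult_right_mono) auto
  also have "\<dots> = 4 ^ k * \<delta>\<^sup>2 + (4 ^ k * \<delta>\<^sup>2)\<^sup>2 / 4 * (n / 4 ^ k)"
    by (simp add: power2_eq_square algebra_simps)
  also have "\<dots> \<le> 4 + 4\<^sup>2 / 4 * (n / 4 ^ k)"
    using d4 by (intro add_mono mult_right_mono divide_right_mono power_mono) auto
  finally have fin: "4 ^ k * ((sin \<delta>)\<^sup>2 + (1 - cos \<delta>)\<^sup>2 * n) \<le> 4 * (1 + n / 4 ^ k)" by simp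
  have "energy (pi / 2) \<le> 4 ^ k * ennreal (6 * \<epsilon>\<^sup>2 * ((sin \<delta>)\<^sup>2 + (1 - cos \<delta>)\<^sup>2 * n))"
    using iter[of k] mult_left_mono[OF energy_bound[OF sp], of "4 ^ k"] by (simp add: \<delta>_def)
  also have "4 ^ k * ennreal (6 * \<epsilon>\<^sup>2 * ((sin \<delta>)\<^sup>2 + (1 - cos \<delta>)\<^sup>2 * n))
      = ennreal (6 * \<epsilon>\<^sup>2 * (4 ^ k * ((sin \<delta>)\<^sup>2 + (1 - cos \<delta>)\<^sup>2 * n)))"
  proof -
    have "(4::ennreal) ^ k = ennreal (4 ^ k)" by (simp add: ennreal_power[symmetric])
    then show ?thesis by (simp add: ennreal_mult[symmetric] mult_ac)
  qed
  also have "\<dots> \<le> ennreal (6 * \<epsilon>\<^sup>2 * (4 * (1 + n / 4 ^ k)))"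
    using fin by (intro ennreal_leI mult_left_mono) auto
  also have "6 * \<epsilon>\<^sup>2 * (4 * (1 + n / 4 ^ k)) = 24 * \<epsilon>\<^sup>2 * (1 + n / 4 ^ k)" by simp
  finally show ?thesis .
qed

text \<open>At the quarter turn the rotated point is the independent copy \<open>y\<close>; letting
  \<open>k\<close> tend to infinity removes the dimension.\<close>

lemma gauss_variance_le:
  "(\<integral>x. (f x - (\<integral>y. f y \<partial>gauss n))\<^sup>2 \<partial>gauss n) \<le> 24 * \<epsilon>\<^sup>2"
proof -
  let ?m = "\<integral>y. f y \<partial>gauss n"
  note mom = gauss_second_moment_about[OF measurable_f square_integrable]
  have var_nonneg: "0 \<le> (\<integral>x. (f x - ?m)\<^sup>2 \<partial>gauss n)" by simp
  have inner: "ennreal ((f x - ?m)\<^sup>2) \<le> (\<integral>\<^sup>+y. ennreal ((f (rot (pi / 2) x y) - f x)\<^sup>2) \<partial>gauss n)" for x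
  proof -
    have e: "f (rot (pi / 2) x y) = f y" for y by (rule f_cong) (simp add: rot_def)
    \<comment> \<open>The right-hand side equals the left-hand side plus the variance. Discarding
      the variance costs a factor 2 in the constant.\<close>
    have "(f x - ?m)\<^sup>2 \<le> (\<integral>y. (f y - f x)\<^sup>2 \<partial>gauss n)"
      using var_nonneg unfolding mom(2) by (simp add: power2_eq_square algebra_simps)
    then show ?thesis unfolding e using mom(1)[of "f x"] by (subst nn_integral_eq_integral) (auto intro: ennreal_leI)
  qed
  have "ennreal (\<integral>x. (f x - ?m)\<^sup>2 \<partial>gauss n) = (\<integral>\<^sup>+x. ennreal ((f x - ?m)\<^sup>2) \<partial>gauss n)"
    using mom(1) by (intro nn_integral_eq_integral[symmetric]) auto
  also have "\<dots> \<le> energy (pi / 2)" unfolding energy_def by (intro nn_integral_mono inner)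
  finally have v: "ennreal (\<integral>x. (f x - ?m)\<^sup>2 \<partial>gauss n) \<le> energy (pi / 2)" .
  have k: "(\<integral>x. (f x - ?m)\<^sup>2 \<partial>gauss n) \<le> 24 * \<epsilon>\<^sup>2 * (1 + n * (1 / 4) ^ k)" for k
  proof -
    have "ennreal (\<integral>x. (f x - ?m)\<^sup>2 \<partial>gauss n) \<le> ennreal (24 * \<epsilon>\<^sup>2 * (1 + n / 4 ^ k))"
      using order_trans[OF v energy_quarter_turn] .
    then show ?thesis by (subst (asm) ennreal_le_iff) (auto simp: power_one_over)
  qed
  have "(\<lambda>k. 24 * \<epsilon>\<^sup>2 * (1 + n * (1 / 4 :: real) ^ k)) \<longlonglongrightarrow> 24 * \<epsilon>\<^sup>2 * (1 + real n * 0)"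
    by (rule tendsto_mult[OF tendsto_const tendsto_add[OF tendsto_const
          tendsto_mult[OF tendsto_const LIMSEQ_power_zero]]]) simp
  from LIMSEQ_le_const[OF this] k show ?thesis by auto
qed

end

section \<open>Projection onto a closed convex set\<close>

locale convex_body =
  fixes n :: nat and K :: "(nat \<Rightarrow> real) set"
  assumes K_Rn: "K \<subseteq> Rn n" and K_ne: "K \<noteq> {}" and K_closed: "eclosed n K"
    and K_convex: "econvex K" and K_bounded: "ebounded n K"
begin

lemma convexD: "u \<in> K \<Longrightarrow> v \<in> K \<Longrightarrow> 0 \<le> t \<Longrightarrow> t \<le> 1 \<Longrightarrow> (\<lambda>i. (1 - t) * u i + t * v i) \<in> K"
  using K_convex unfolding econvex_def by blast

lemma ediam_bdd: "bdd_above {edist n u v | u v. u \<in> K \<and> v \<in> K}"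
  using K_bounded unfolding ebounded_def bdd_above_def by blast

lemma edist_le_ediam: "u \<in> K \<Longrightarrow> v \<in> K \<Longrightarrow> edist n u v \<le> ediam n K"
  unfolding ediam_def by (rule cSup_upper[OF _ ediam_bdd]) blast

lemma ediam_nonneg: "0 \<le> ediam n K"
  using K_ne edist_le_ediam edist_nonneg order_trans by blast

text \<open>By the parallelogram identity a minimising sequence is Cauchy: its midpoints lie in
  \<open>K\<close> and cannot beat the infimum. Coordinatewise limits and closedness then give the
  minimiser.\<close>

lemma nearest_exists: "\<exists>p\<in>K. \<forall>\<nu>\<in>K. (edist n y p)\<^sup>2 \<le> (edist n y \<nu>)\<^sup>2"
proof -
  define m where "m = (INF \<nu>\<in>K. (edist n y \<nu>)\<^sup>2)"
  have m_le: "m \<le> (edist n y \<nu>)\<^sup>2" if "\<nu> \<in> K" for \<nu>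
    unfolding m_def by (rule cINF_lower[OF _ that]) (auto intro!: bdd_belowI[of _ 0])
  have "\<exists>\<nu>\<in>K. (edist n y \<nu>)\<^sup>2 < m + e" if "e > 0" for e
  proof (rule ccontr)
    assume "\<not> ?thesis"
    then have "m + e \<le> m" unfolding m_def by (intro cINF_greatest K_ne) (auto simp: not_less)
    with that show False by simp
  qed
  then have "\<exists>\<nu>\<in>K. (edist n y \<nu>)\<^sup>2 < m + inverse (real (Suc k))" for k by simp
  then obtain f where f: "\<And>k. f k \<in> K" "\<And>k. (edist n y (f k))\<^sup>2 < m + inverse (real (Suc k))"
    by metis
  have par: "(edist n (f j) (f k))\<^sup>2 \<le> 2 * inverse (real (Suc j)) + 2 * inverse (real (Suc k))" for j k
  proof -
    let ?mid = "\<lambda>i. (1 - 1/2) * f j i + (1/2) * f k i"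
    have "(edist n (f j) (f k))\<^sup>2 = 2 * (edist n y (f j))\<^sup>2 + 2 * (edist n y (f k))\<^sup>2 - 4 * (edist n y ?mid)\<^sup>2"
      unfolding edist_sq ip_def
      by (simp add: sum_distrib_left sum.distrib[symmetric] sum_subtractf[symmetric])
         (rule sum.cong, simp_all add: field_simps)
    moreover have "m \<le> (edist n y ?mid)\<^sup>2" by (intro m_le convexD f) auto
    ultimately show ?thesis using f(2)[of j] f(2)[of k] by simp
  qed
  have inv0: "(\<lambda>k. inverse (real (Suc k))) \<longlonglongrightarrow> 0" by (rule LIMSEQ_inverse_real_of_nat)
  have "Cauchy (\<lambda>k. f k i)" if "i < n" for i
  proof (rule metric_CauchyI)
    fix e :: real assume e: "e > 0"
    then have "eventually (\<lambda>k. inverse (real (Suc k)) < e\<^sup>2 / 4) sequentially"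
      by (intro order_tendstoD(2)[OF inv0]) simp
    then obtain M where M: "\<And>k. k \<ge> M \<Longrightarrow> inverse (real (Suc k)) < e\<^sup>2 / 4"
      unfolding eventually_sequentially by blast
    have "dist (f j i) (f k i) < e" if "j \<ge> M" "k \<ge> M" for j k
    proof -
      have "(f j i - f k i)\<^sup>2 \<le> (\<Sum>i<n. (f j i - f k i)\<^sup>2)"
        using \<open>i < n\<close> by (intro member_le_sum) auto
      also have "\<dots> = (edist n (f j) (f k))\<^sup>2" by (simp add: edist_def sum_nonneg)
      also have "\<dots> < e\<^sup>2" using par[of j k] M[OF that(1)] M[OF that(2)] by simp
      finally show ?thesis
        using e power2_less_imp_less[of "\<bar>f j i - f k i\<bar>" e] by (simp add: dist_real_def)
    qed
    then show "\<exists>M. \<forall>j\<ge>M. \<forall>k\<ge>M. dist (f j i) (f k i) < e" by blast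
  qed
  then have "\<And>i. i < n \<Longrightarrow> \<exists>l. (\<lambda>k. f k i) \<longlonglongrightarrow> l"
    using Cauchy_convergent_iff convergent_def by blast
  then obtain l where l: "\<And>i. i < n \<Longrightarrow> (\<lambda>k. f k i) \<longlonglongrightarrow> l i" by metis
  \<comment> \<open>The limit is extended by 0 because \<open>eclosed\<close> speaks only of limit
    points in \<open>Rn n\<close>.\<close>
  define p where "p i = (if i < n then l i else 0)" for i
  have pl: "(\<lambda>k. f k i) \<longlonglongrightarrow> p i" if "i < n" for i using l that by (simp add: p_def)
  have "(\<lambda>k. edist n (f k) p) \<longlonglongrightarrow> sqrt (\<Sum>i<n. (p i - p i)\<^sup>2)"
    unfolding edist_def by (intro tendsto_intros pl) simp
  then have "(\<lambda>k. edist n (f k) p) \<longlonglongrightarrow> 0" by simp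
  moreover have "p \<in> Rn n" by (simp add: Rn_def p_def)
  ultimately have "p \<in> K"
    using K_closed f(1) unfolding eclosed_def by blast
  moreover have "(edist n y p)\<^sup>2 \<le> m"
  proof (rule LIMSEQ_le)
    show "(\<lambda>k. (edist n y (f k))\<^sup>2) \<longlonglongrightarrow> (edist n y p)\<^sup>2"
      unfolding edist_def by (intro tendsto_intros pl) simp
    show "(\<lambda>k. m + inverse (real (Suc k))) \<longlonglongrightarrow> m"
      using tendsto_add[OF tendsto_const inv0, of m] by simp
    show "\<exists>N. \<forall>k\<ge>N. (edist n y (f k))\<^sup>2 \<le> m + inverse (real (Suc k))"
      using f(2) less_imp_le by blast
  qed
  ultimately show ?thesis using m_le order_trans by blast
qed

text \<open>First-order optimality: moving from \<open>p\<close> a fraction \<open>t\<close> towards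
  \<open>v\<close> changes the squared distance by \<open>t^2 * ?b - 2 * t * ?a\<close>, which is
  never negative. Divide by \<open>t\<close> and let \<open>t\<close> tend to 0.\<close>

lemma nearest_obtuse:
  assumes p: "p \<in> K" "\<forall>\<nu>\<in>K. (edist n y p)\<^sup>2 \<le> (edist n y \<nu>)\<^sup>2" and v: "v \<in> K"
  shows "ip n (\<lambda>i. y i - p i) (\<lambda>i. v i - p i) \<le> 0"
proof -
  let ?a = "ip n (\<lambda>i. y i - p i) (\<lambda>i. v i - p i)" and ?b = "(edist n v p)\<^sup>2"
  have "2 * ?a \<le> t * ?b" if t: "0 < t" "t \<le> 1" for t
  proof -
    have "(edist n y p)\<^sup>2 \<le> (edist n y (\<lambda>i. (1 - t) * p i + t * v i))\<^sup>2"
      using p v t by (auto intro!: convexD)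
    also have "\<dots> = (edist n y p)\<^sup>2 - 2 * t * ?a + t\<^sup>2 * ?b"
      unfolding edist_sq ip_def
      by (simp add: sum_distrib_left sum.distrib[symmetric] sum_subtractf[symmetric])
         (rule sum.cong, simp_all add: algebra_simps power2_eq_square)
    finally have "t * (2 * ?a) \<le> t * (t * ?b)" by (simp add: power2_eq_square mult_ac)
    then show ?thesis using t by simp
  qed
  then have *: "2 * ?a \<le> inverse (real (Suc k)) * ?b" for k
    by (simp add: inverse_le_1_iff)
  have "(\<lambda>k. inverse (real (Suc k)) * ?b) \<longlonglongrightarrow> 0 * ?b"
    by (intro tendsto_mult LIMSEQ_inverse_real_of_nat tendsto_const)
  from LIMSEQ_le_const[OF this] * have "2 * ?a \<le> 0" by simp
  then show ?thesis by simp
qed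

text \<open>The two obtuse-angle inequalities bound the squared distance by the inner product of
  \<open>?e\<close> and \<open>?d\<close>, to which Cauchy-Schwarz applies. The case
  \<open>y = z\<close> is the uniqueness that makes the description in \<open>lse\<close>
  meaningful.\<close>

lemma nearest_contraction:
  assumes p: "p \<in> K" "\<forall>\<nu>\<in>K. (edist n y p)\<^sup>2 \<le> (edist n y \<nu>)\<^sup>2"
    and q: "q \<in> K" "\<forall>\<nu>\<in>K. (edist n z q)\<^sup>2 \<le> (edist n z \<nu>)\<^sup>2"
  shows "edist n p q \<le> edist n y z"
proof -
  let ?d = "\<lambda>i. p i - q i" and ?e = "\<lambda>i. y i - z i"
  have "(edist n p q)\<^sup>2 = ip n ?e ?d + ip n (\<lambda>i. y i - p i) (\<lambda>i. q i - p i) + ip n (\<lambda>i. z i - q i) (\<lambda>i. p i - q i)"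
    unfolding edist_sq ip_def by (simp add: sum.distrib[symmetric]) (rule sum.cong, simp_all add: algebra_simps)
  also have "\<dots> \<le> ip n ?e ?d" using nearest_obtuse[OF p q(1)] nearest_obtuse[OF q p(1)] by simp
  also have "\<dots> \<le> edist n y z * edist n p q"
    using ip_cauchy_schwarz[of n ?e ?d] by (simp add: edist_enorm)
  finally have "edist n p q * edist n p q \<le> edist n y z * edist n p q" by (simp add: power2_eq_square)
  then show ?thesis
    using edist_nonneg[of n p q] edist_nonneg[of n y z] by (cases "edist n p q = 0") (auto simp: mult_le_cancel_right)
qed

lemma edist_eq_0:
  assumes "u \<in> K" "v \<in> K" "edist n u v = 0" shows "u = v"
proof
  fix i
  show "u i = v i"
  proof (cases "i < n")
    case True
    then show ?thesis using assms(3) by (simp add: edist_enorm L2_set_eq_0_iff)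
  next
    case False
    then show ?thesis using subsetD[OF K_Rn assms(1)] subsetD[OF K_Rn assms(2)] by (simp add: Rn_def)
  qed
qed

lemma lse_nearest: "lse n K y \<in> K \<and> (\<forall>\<nu>\<in>K. (edist n y (lse n K y))\<^sup>2 \<le> (edist n y \<nu>)\<^sup>2)"
proof -
  have "\<exists>!\<nu>. \<nu> \<in> K \<and> (\<forall>\<nu>'\<in>K. (edist n y \<nu>)\<^sup>2 \<le> (edist n y \<nu>')\<^sup>2)"
  proof (rule ex_ex1I)
    fix p q
    assume "p \<in> K \<and> (\<forall>\<nu>'\<in>K. (edist n y p)\<^sup>2 \<le> (edist n y \<nu>')\<^sup>2)"
      "q \<in> K \<and> (\<forall>\<nu>'\<in>K. (edist n y q)\<^sup>2 \<le> (edist n y \<nu>')\<^sup>2)"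
    then have "edist n p q \<le> edist n y y" "p \<in> K" "q \<in> K" using nearest_contraction by blast+
    then show "p = q" using edist_eq_0 edist_nonneg[of n p q] by auto
  qed (use nearest_exists in blast)
  from theI'[OF this] show ?thesis unfolding lse_def .
qed

lemma lse_in: "lse n K y \<in> K"
  using lse_nearest by blast

lemma lse_contraction: "edist n (lse n K y) (lse n K z) \<le> edist n y z"
  using nearest_contraction lse_nearest by blast

end

section \<open>The estimation error and the local width\<close>

locale lse_risk = convex_body +
  fixes \<mu> :: "nat \<Rightarrow> real" and \<sigma> :: real
  assumes mu_in: "\<mu> \<in> K" and sigma_pos: "0 < \<sigma>"
begin

definition err :: "(nat \<Rightarrow> real) \<Rightarrow> real" where
  "err x = edist n (lse n K (obs n \<mu> \<sigma> x)) \<mu>"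

definition h :: "real \<Rightarrow> (nat \<Rightarrow> real) \<Rightarrow> real" where
  "h s x = (SUP t\<in>{t\<in>K. edist n t \<mu> \<le> s}. ip n x (\<lambda>i. t i - \<mu> i))"

lemma err_nonneg: "0 \<le> err x"
  by (simp add: err_def)

lemma err_le_ediam: "err x \<le> ediam n K"
  unfolding err_def by (intro edist_le_ediam lse_in mu_in)

text \<open>The projection does not expand distances and the noise enters scaled by
  \<open>\<sigma>\<close>. This is the source of measurability and square integrability of the
  error.\<close>

lemma err_lipschitz: "\<bar>err x - err y\<bar> \<le> \<sigma> * edist n x y"
proof -
  have "edist n (obs n \<mu> \<sigma> x) (obs n \<mu> \<sigma> y) = enorm n (\<lambda>i. \<sigma> * (x i - y i))"
    unfolding edist_enorm by (rule L2_set_cong) (auto simp: obs_def algebra_simps)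
  also have "\<dots> = \<sigma> * edist n x y"
    using sigma_pos by (simp add: edist_enorm L2_set_right_distrib)
  finally have "edist n (lse n K (obs n \<mu> \<sigma> x)) (lse n K (obs n \<mu> \<sigma> y)) \<le> \<sigma> * edist n x y"
    using lse_contraction by metis
  then show ?thesis
    unfolding err_def
    using edist_triangle[of n "lse n K (obs n \<mu> \<sigma> x)" \<mu> "lse n K (obs n \<mu> \<sigma> y)"]
      edist_triangle[of n "lse n K (obs n \<mu> \<sigma> y)" \<mu> "lse n K (obs n \<mu> \<sigma> x)"]
    by (simp add: edist_commute abs_le_iff)
qed

lemma err_measurable [measurable]: "err \<in> borel_measurable (gauss n)"
  using err_lipschitz by (rule edist_lipschitz_measurable)

lemma err_sq_integrable: "integrable (gauss n) (\<lambda>x. (err x)\<^sup>2)"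
  using err_lipschitz by (rule gauss_lipschitz_square_integrable)

lemma err_sq_integral_le: "(\<integral>x. (err x)\<^sup>2 \<partial>gauss n) \<le> (ediam n K)\<^sup>2"
proof -
  have "(\<integral>x. (err x)\<^sup>2 \<partial>gauss n) \<le> (\<integral>x. (ediam n K)\<^sup>2 \<partial>gauss n)"
    using err_sq_integrable err_nonneg err_le_ediam by (intro integral_mono power_mono) auto
  then show ?thesis by (simp add: gauss.prob_space)
qed

section \<open>The localised supremum \<open>h\<close> as a function of the radius and of the
  noise\<close>

lemma ip_increment_le:
  "edist n t \<mu> \<le> s \<Longrightarrow> ip n x (\<lambda>i. t i - \<mu> i) \<le> enorm n x * s"
  using ip_cauchy_schwarz[of n x "\<lambda>i. t i - \<mu> i"] mult_left_mono[of "edist n t \<mu>" s "enorm n x"]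
  by (simp add: edist_enorm)

lemma h_bdd: "bdd_above ((\<lambda>t. ip n x (\<lambda>i. t i - \<mu> i)) ` {t\<in>K. edist n t \<mu> \<le> s})"
  using ip_increment_le by (intro bdd_aboveI2) blast

lemma h_upper: "t \<in> K \<Longrightarrow> edist n t \<mu> \<le> s \<Longrightarrow> ip n x (\<lambda>i. t i - \<mu> i) \<le> h s x"
  unfolding h_def by (rule cSUP_upper[OF _ h_bdd]) simp

lemma h_least:
  assumes "0 \<le> s" "\<And>t. t \<in> K \<Longrightarrow> edist n t \<mu> \<le> s \<Longrightarrow> ip n x (\<lambda>i. t i - \<mu> i) \<le> B"
  shows "h s x \<le> B"
  unfolding h_def by (rule cSUP_least) (use assms mu_in in auto)

lemma h_near:
  assumes "0 \<le> s" "0 < \<eta>"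
  obtains t where "t \<in> K" "edist n t \<mu> \<le> s" "h s x - \<eta> < ip n x (\<lambda>i. t i - \<mu> i)"
proof -
  have "\<exists>t. t \<in> K \<and> edist n t \<mu> \<le> s \<and> h s x - \<eta> < ip n x (\<lambda>i. t i - \<mu> i)"
  proof (rule ccontr)
    assume "\<not> ?thesis"
    then have "h s x \<le> h s x - \<eta>" using assms by (intro h_least) (auto simp: not_less)
    then show False using assms by simp
  qed
  then show ?thesis using that by blast
qed

lemma h_mono:
  assumes "0 \<le> s" "s \<le> s'" shows "h s x \<le> h s' x"
  using assms by (intro h_least h_upper) auto

text \<open>For a supremum of linear functions of \<open>x\<close>, a near-maximiser
  \<open>t\<close> supplies the approximate subgradient \<open>t - \<mu>\<close>. Its norm is at
  most \<open>s\<close>, so \<open>h s\<close> fluctuates by order \<open>s\<close> in any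
  dimension.\<close>

lemma h_subgradient:
  assumes s: "0 \<le> s"
  shows "gauss_subgradient n (h s) s"
proof
  fix x :: "nat \<Rightarrow> real" and \<eta> :: real assume "\<eta> > 0"
  with s obtain t where t: "t \<in> K" "edist n t \<mu> \<le> s" "h s x - \<eta> < ip n x (\<lambda>i. t i - \<mu> i)"
    by (rule h_near)
  let ?t = "\<lambda>i. t i - \<mu> i"
  have "h s y \<ge> h s x + ip n ?t (\<lambda>i. y i - x i) - \<eta>" for y
  proof -
    have "ip n ?t (\<lambda>i. y i - x i) = ip n y ?t - ip n x ?t"
      by (simp add: ip_def algebra_simps sum_subtractf sum.distrib)
    then show ?thesis using t(3) h_upper[OF t(1,2), of y] by simp
  qed
  then show "\<exists>t. enorm n t \<le> s \<and> (\<forall>y. h s x + ip n t (\<lambda>i. y i - x i) - \<eta> \<le> h s y)"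
    using t(2) by (intro exI[of _ ?t]) (simp add: edist_enorm)
qed

text \<open>A mixture of near-maximisers for \<open>a\<close> and \<open>b\<close> stays in
  \<open>K\<close> by convexity, and in the ball of the mixed radius by the triangle
  inequality.\<close>

lemma h_concave:
  assumes "0 \<le> a" "0 \<le> b" "0 \<le> l" "l \<le> 1"
  shows "(1 - l) * h a x + l * h b x \<le> h ((1 - l) * a + l * b) x"
proof (rule field_le_epsilon)
  fix \<eta> :: real assume "\<eta> > 0"
  obtain u where u: "u \<in> K" "edist n u \<mu> \<le> a" "h a x - \<eta> < ip n x (\<lambda>i. u i - \<mu> i)"
    using h_near[OF assms(1) \<open>\<eta> > 0\<close>] by blast
  obtain v where v: "v \<in> K" "edist n v \<mu> \<le> b" "h b x - \<eta> < ip n x (\<lambda>i. v i - \<mu> i)"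
    using h_near[OF assms(2) \<open>\<eta> > 0\<close>] by blast
  let ?w = "\<lambda>i. (1 - l) * u i + l * v i"
  have "edist n ?w \<mu> = enorm n (\<lambda>i. (1 - l) * (u i - \<mu> i) + l * (v i - \<mu> i))"
    unfolding edist_enorm by (rule L2_set_cong) (auto simp: algebra_simps)
  also have "\<dots> \<le> enorm n (\<lambda>i. (1 - l) * (u i - \<mu> i)) + enorm n (\<lambda>i. l * (v i - \<mu> i))"
    by (rule L2_set_triangle_ineq)
  also have "\<dots> = (1 - l) * edist n u \<mu> + l * edist n v \<mu>"
    using assms by (simp add: edist_enorm L2_set_right_distrib)
  also have "\<dots> \<le> (1 - l) * a + l * b"
    using assms u v by (intro add_mono mult_left_mono) auto
  finally have "ip n x (\<lambda>i. ?w i - \<mu> i) \<le> h ((1 - l) * a + l * b) x"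
    using assms u v by (intro h_upper convexD) auto
  moreover have "ip n x (\<lambda>i. ?w i - \<mu> i) = (1 - l) * ip n x (\<lambda>i. u i - \<mu> i) + l * ip n x (\<lambda>i. v i - \<mu> i)"
    unfolding ip_def sum_distrib_left sum.distrib[symmetric] by (rule sum.cong) (auto simp: algebra_simps)
  moreover have "(1 - l) * (h a x - \<eta>) + l * (h b x - \<eta>) \<le> (1 - l) * ip n x (\<lambda>i. u i - \<mu> i) + l * ip n x (\<lambda>i. v i - \<mu> i)"
    using assms u v by (intro add_mono mult_left_mono) auto
  ultimately show "(1 - l) * h a x + l * h b x \<le> h ((1 - l) * a + l * b) x + \<eta>"
    by (simp add: algebra_simps)
qed

text \<open>Concavity in chord form: chords starting at \<open>a\<close> flatten as they get longer.
  Cross-multiplication includes the degenerate intervals.\<close>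

lemma h_slope:
  assumes "0 \<le> a" "a \<le> b" "b \<le> r"
  shows "(b - a) * (h r x - h a x) \<le> (r - a) * (h b x - h a x)"
proof (cases "a = r")
  case False
  with assms have ar: "a < r" by simp
  define l where "l = (b - a) / (r - a)"
  have l: "0 \<le> l" "l \<le> 1" "(r - a) * l = b - a" using assms ar by (auto simp: l_def)
  have lb: "(1 - l) * a + l * r = b" using l(3) by (simp add: algebra_simps)
  have "0 \<le> r" using assms by linarith
  from h_concave[OF assms(1) this l(1,2), of x]
  have "(1 - l) * h a x + l * h r x \<le> h b x" unfolding lb .
  then have "(1 - l) * h a x + l * h r x - h a x \<le> h b x - h a x" by (rule diff_right_mono)
  also have "(1 - l) * h a x + l * h r x - h a x = l * (h r x - h a x)" by algebra
  finally have "l * (h r x - h a x) \<le> h b x - h a x" .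
  then have "(r - a) * (l * (h r x - h a x)) \<le> (r - a) * (h b x - h a x)"
    using ar by (intro mult_left_mono) auto
  then show ?thesis using l(3) by (simp add: mult.assoc[symmetric])
qed (use assms in auto)

lemma err_maximal:
  assumes s: "0 \<le> s"
  shows "\<sigma> * h s x - s\<^sup>2 / 2 \<le> \<sigma> * h (err x) x - (err x)\<^sup>2 / 2"
proof -
  let ?y = "obs n \<mu> \<sigma> x" and ?p = "lse n K (obs n \<mu> \<sigma> x)"
  have exp: "(edist n ?y t)\<^sup>2 = \<sigma>\<^sup>2 * ip n x x - 2 * \<sigma> * ip n x (\<lambda>i. t i - \<mu> i) + (edist n t \<mu>)\<^sup>2" for t
    unfolding edist_sq ip_def sum_distrib_left sum.distrib[symmetric] sum_subtractf[symmetric]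
    by (rule sum.cong) (auto simp: obs_def algebra_simps power2_eq_square)
  have "h s x \<le> (\<sigma> * h (err x) x - (err x)\<^sup>2 / 2 + s\<^sup>2 / 2) / \<sigma>"
  proof (rule h_least[OF s])
    fix t assume t: "t \<in> K" "edist n t \<mu> \<le> s"
    have "(edist n ?y ?p)\<^sup>2 \<le> (edist n ?y t)\<^sup>2" using lse_nearest t(1) by blast
    then have "\<sigma> * ip n x (\<lambda>i. t i - \<mu> i) \<le> \<sigma> * ip n x (\<lambda>i. ?p i - \<mu> i) - (err x)\<^sup>2 / 2 + (edist n t \<mu>)\<^sup>2 / 2"
      unfolding exp err_def by (simp add: field_simps)
    moreover have "\<sigma> * ip n x (\<lambda>i. ?p i - \<mu> i) \<le> \<sigma> * h (err x) x"
      using sigma_pos by (intro mult_left_mono h_upper lse_in) (auto simp: err_def)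
    moreover have "(edist n t \<mu>)\<^sup>2 \<le> s\<^sup>2" using t(2) by (intro power_mono) auto
    ultimately have "\<sigma> * ip n x (\<lambda>i. t i - \<mu> i) \<le> \<sigma> * h (err x) x - (err x)\<^sup>2 / 2 + s\<^sup>2 / 2"
      by linarith
    then show "ip n x (\<lambda>i. t i - \<mu> i) \<le> (\<sigma> * h (err x) x - (err x)\<^sup>2 / 2 + s\<^sup>2 / 2) / \<sigma>"
      using sigma_pos by (simp add: pos_le_divide_eq mult.commute)
  qed
  then show ?thesis using sigma_pos by (simp add: field_simps)
qed

text \<open>If \<open>r = err x\<close> exceeds \<open>b\<close>, optimality against radius
  \<open>a\<close> bounds \<open>(r^2 - a^2) / 2\<close> by
  \<open>\<sigma> * (h r x - h a x)\<close>, and concavity bounds this increment by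
  \<open>(r - a) / (b - a)\<close> times the one over \<open>[a, b]\<close>. Cancelling
  \<open>r - a\<close> bounds \<open>r + a\<close>. A sum of squares in place of a maximum can be
  integrated directly.\<close>

lemma err_upper:
  assumes "0 \<le> a" "a < b"
  shows "(err x)\<^sup>2 \<le> b\<^sup>2 + 4 * \<sigma>\<^sup>2 / (b - a)\<^sup>2 * (h b x - h a x)\<^sup>2"
proof (cases "err x \<le> b")
  case True
  then have "(err x)\<^sup>2 \<le> b\<^sup>2" using err_nonneg by (intro power_mono)
  then show ?thesis by (simp add: add_increasing2)
next
  case False
  let ?r = "err x"
  have r: "b < ?r" using False by simp
  have "(?r\<^sup>2 - a\<^sup>2) / 2 \<le> \<sigma> * (h ?r x - h a x)"
    using err_maximal[of a x] assms by (simp add: algebra_simps diff_divide_distrib)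
  then have "(b - a) * ((?r\<^sup>2 - a\<^sup>2) / 2) \<le> (b - a) * (\<sigma> * (h ?r x - h a x))"
    using assms by (intro mult_left_mono) auto
  also have "\<dots> = \<sigma> * ((b - a) * (h ?r x - h a x))" by simp
  also have "\<dots> \<le> \<sigma> * ((?r - a) * (h b x - h a x))"
    using h_slope[of a b ?r x] assms r sigma_pos by (intro mult_left_mono) auto
  finally have "2 * ((b - a) * ((?r\<^sup>2 - a\<^sup>2) / 2)) \<le> 2 * (\<sigma> * ((?r - a) * (h b x - h a x)))"
    by simp
  also have "2 * ((b - a) * ((?r\<^sup>2 - a\<^sup>2) / 2)) = (b - a) * (?r\<^sup>2 - a\<^sup>2)"
    by simp
  also have "\<dots> = (?r - a) * ((b - a) * (?r + a))"
    by algebra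
  finally have "(?r - a) * ((b - a) * (?r + a)) \<le> (?r - a) * (2 * \<sigma> * (h b x - h a x))"
    by (simp only: mult_ac)
  then have "(b - a) * (?r + a) \<le> 2 * \<sigma> * (h b x - h a x)"
    using assms r by simp
  then have "(b - a) * ?r \<le> 2 * \<sigma> * (h b x - h a x)"
    using mult_nonneg_nonneg[of "b - a" a] assms unfolding distrib_left by linarith
  then have "((b - a) * ?r)\<^sup>2 \<le> (2 * \<sigma> * (h b x - h a x))\<^sup>2"
    using assms err_nonneg[of x] by (intro power_mono) auto
  then have "?r\<^sup>2 * (b - a)\<^sup>2 \<le> 4 * \<sigma>\<^sup>2 * (h b x - h a x)\<^sup>2"
    unfolding power_mult_distrib by (simp add: mult.commute)
  moreover have "0 < (b - a)\<^sup>2" using assms by simp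
  ultimately have "?r\<^sup>2 \<le> 4 * \<sigma>\<^sup>2 * (h b x - h a x)\<^sup>2 / (b - a)\<^sup>2"
    by (simp only: pos_le_divide_eq)
  then show ?thesis by (simp add: add_increasing)
qed

text \<open>Optimality against radius \<open>a\<close> bounds the slope on \<open>[err x, a]\<close>
  by \<open>(a + err x) / (2 * \<sigma>)\<close>, hence by \<open>3 / 4 * a / \<sigma>\<close>, and
  concavity carries this over to \<open>[a, b]\<close>. The threshold of \<open>epsbar\<close>
  corresponds to the larger slope \<open>(a + b) / (2 * \<sigma>)\<close>.\<close>

lemma err_lower:
  assumes "0 < a" "a < b" "err x \<le> a / 2"
  shows "h b x - h a x \<le> (b - a) * (3 / 4 * a) / \<sigma>"
proof -
  let ?r = "err x"
  have r: "0 \<le> ?r" "?r < a" using assms err_nonneg[of x] by auto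
  have "(a - ?r) * (h b x - h ?r x) \<le> (b - ?r) * (h a x - h ?r x)"
    using assms r by (intro h_slope) auto
  then have 1: "(a - ?r) * (h b x - h a x) \<le> (b - a) * (h a x - h ?r x)"
    by (simp add: algebra_simps)
  have "\<sigma> * (h a x - h ?r x) \<le> (a\<^sup>2 - ?r\<^sup>2) / 2"
    using err_maximal[of a x] assms by (simp add: algebra_simps diff_divide_distrib)
  also have "\<dots> = (a - ?r) * ((a + ?r) / 2)" by (simp add: power2_eq_square algebra_simps)
  also have "\<dots> \<le> (a - ?r) * (3 / 4 * a)" using assms r by (intro mult_left_mono) auto
  finally have "(b - a) * (\<sigma> * (h a x - h ?r x)) \<le> (b - a) * ((a - ?r) * (3 / 4 * a))"
    using assms by (intro mult_left_mono) auto
  moreover have "\<sigma> * ((a - ?r) * (h b x - h a x)) \<le> \<sigma> * ((b - a) * (h a x - h ?r x))"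
    using 1 sigma_pos by (intro mult_left_mono) auto
  moreover have "\<sigma> * ((b - a) * (h a x - h ?r x)) = (b - a) * (\<sigma> * (h a x - h ?r x))"
    "\<sigma> * ((a - ?r) * (h b x - h a x)) = (a - ?r) * (\<sigma> * (h b x - h a x))"
    "(b - a) * ((a - ?r) * (3 / 4 * a)) = (a - ?r) * ((b - a) * (3 / 4 * a))"
    by (simp_all only: mult_ac)
  ultimately have "(a - ?r) * (\<sigma> * (h b x - h a x)) \<le> (a - ?r) * ((b - a) * (3 / 4 * a))"
    by linarith
  then have "\<sigma> * (h b x - h a x) \<le> (b - a) * (3 / 4 * a)"
    by (rule mult_left_le_imp_le) (use r in simp)
  then show ?thesis using sigma_pos by (simp add: field_simps)
qed

section \<open>Means and fluctuations of \<open>h\<close>, and the risk at a single point\<close>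

definition w :: "real \<Rightarrow> real" where
  "w s = (\<integral>x. h s x \<partial>gauss n)"

lemma h_integrable: "0 \<le> s \<Longrightarrow> integrable (gauss n) (h s)"
  using gauss_subgradient.integrable_f h_subgradient by blast

lemma h_measurable: "0 \<le> s \<Longrightarrow> h s \<in> borel_measurable (gauss n)"
  using gauss_subgradient.measurable_f h_subgradient by blast

lemma h_sq_integrable: "0 \<le> s \<Longrightarrow> integrable (gauss n) (\<lambda>x. (h s x)\<^sup>2)"
  using gauss_subgradient.square_integrable h_subgradient by blast

lemma h_variance: "0 \<le> s \<Longrightarrow> (\<integral>x. (h s x - w s)\<^sup>2 \<partial>gauss n) \<le> 24 * s\<^sup>2"
  unfolding w_def using gauss_subgradient.gauss_variance_le h_subgradient by blast

text \<open>\<open>lgw\<close> pairs the noise with \<open>t\<close>, \<open>h\<close> pairs it with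
  \<open>t - \<mu>\<close>; the difference \<open>ip n x \<mu>\<close> has mean 0.\<close>

lemma lgw_eq_w:
  assumes "0 \<le> s"
  shows "lgw n K \<mu> s = w s"
proof -
  have e: "(SUP t\<in>{t\<in>K. edist n t \<mu> \<le> s}. ip n x t) = h s x + ip n x \<mu>" (is "?L x = _") for x
  proof (rule antisym)
    have split: "ip n x t = ip n x (\<lambda>i. t i - \<mu> i) + ip n x \<mu>" for t
      by (simp add: ip_def sum.distrib[symmetric] algebra_simps)
    have le: "ip n x t \<le> h s x + ip n x \<mu>" if "t \<in> {t\<in>K. edist n t \<mu> \<le> s}" for t
      using split[of t] h_upper[of t s x] that by simp
    show "?L x \<le> h s x + ip n x \<mu>"
      by (rule cSUP_least[OF _ le]) (use mu_in assms in auto)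
    have bdd: "bdd_above ((\<lambda>t. ip n x t) ` {t\<in>K. edist n t \<mu> \<le> s})"
      by (rule bdd_aboveI2[OF le])
    have "h s x \<le> ?L x - ip n x \<mu>"
    proof (rule h_least[OF assms])
      fix t assume "t \<in> K" "edist n t \<mu> \<le> s"
      then have "ip n x t \<le> ?L x" by (intro cSUP_upper bdd) auto
      then show "ip n x (\<lambda>i. t i - \<mu> i) \<le> ?L x - ip n x \<mu>" using split[of t] by simp
    qed
    then show "h s x + ip n x \<mu> \<le> ?L x" by simp
  qed
  show ?thesis
    unfolding lgw_def e w_def
    by (subst Bochner_Integration.integral_add[OF h_integrable[OF assms] gauss_ip(1)])
       (simp only: gauss_ip add_0_right)
qed

lemma w_mono: "0 \<le> s \<Longrightarrow> s \<le> s' \<Longrightarrow> w s \<le> w s'"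
  unfolding w_def by (intro integral_mono h_integrable h_mono) auto

lemma w_nonneg: "0 \<le> s \<Longrightarrow> 0 \<le> w s"
  unfolding w_def using h_upper[OF mu_in, of s] by (intro integral_nonneg_AE) (auto simp: ip_def)

lemma w_le:
  assumes "0 \<le> s" shows "w s \<le> (\<integral>x. enorm n x \<partial>gauss n) * s"
proof -
  have "integrable (gauss n) (enorm n)"
    by (rule gauss_square_integrable_imp_integrable) (auto intro: gauss_enorm_sq)
  then have "w s \<le> (\<integral>x. enorm n x * s \<partial>gauss n)"
    unfolding w_def using assms
    by (intro integral_mono h_integrable h_least ip_increment_le integrable_mult_left) auto
  then show ?thesis by simp
qed

lemma increment_sq_integrable:
  assumes "0 \<le> a" "0 \<le> b"
  shows "integrable (gauss n) (\<lambda>x. (h b x - h a x - m)\<^sup>2)"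
proof (rule Bochner_Integration.integrable_bound)
  show "integrable (gauss n) (\<lambda>x. 3 * (h b x)\<^sup>2 + 3 * (h a x)\<^sup>2 + 3 * m\<^sup>2)"
    using h_sq_integrable assms by simp
  show "(\<lambda>x. (h b x - h a x - m)\<^sup>2) \<in> borel_measurable (gauss n)"
    using h_measurable[OF assms(1)] h_measurable[OF assms(2)] by measurable
  have "(u - v - m)\<^sup>2 \<le> 3 * u\<^sup>2 + 3 * v\<^sup>2 + 3 * m\<^sup>2" for u v :: real
    using zero_le_power2[of "u + v"] zero_le_power2[of "u + m"] zero_le_power2[of "v - m"]
    by (simp add: power2_eq_square algebra_simps)
  then show "AE x in gauss n. norm ((h b x - h a x - m)\<^sup>2) \<le> norm (3 * (h b x)\<^sup>2 + 3 * (h a x)\<^sup>2 + 3 * m\<^sup>2)"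
    by (auto intro: order_trans[OF _ abs_ge_self])
qed

text \<open>A difference of convex functions need not have subgradients, so the two terms are
  treated separately; 48 is twice the 24 of the variance bound.\<close>

lemma increment_variance:
  assumes "0 \<le> a" "0 \<le> b"
  shows "(\<integral>x. (h b x - h a x - (w b - w a))\<^sup>2 \<partial>gauss n) \<le> 48 * (a\<^sup>2 + b\<^sup>2)"
proof -
  have i: "integrable (gauss n) (\<lambda>x. (h s x - w s)\<^sup>2)" if "0 \<le> s" for s
    by (rule gauss_second_moment_about(1)[OF h_measurable[OF that] h_sq_integrable[OF that]])
  have "(\<integral>x. (h b x - h a x - (w b - w a))\<^sup>2 \<partial>gauss n)
      \<le> (\<integral>x. 2 * (h b x - w b)\<^sup>2 + 2 * (h a x - w a)\<^sup>2 \<partial>gauss n)"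
  proof (rule integral_mono)
    show "integrable (gauss n) (\<lambda>x. (h b x - h a x - (w b - w a))\<^sup>2)"
      by (rule increment_sq_integrable[OF assms])
    show "integrable (gauss n) (\<lambda>x. 2 * (h b x - w b)\<^sup>2 + 2 * (h a x - w a)\<^sup>2)"
      using i assms by simp
    have "(p - q - (p' - q'))\<^sup>2 \<le> 2 * (p - p')\<^sup>2 + 2 * (q - q')\<^sup>2" for p q p' q' :: real
      using zero_le_power2[of "(p - p') + (q - q')"] by (simp add: power2_eq_square algebra_simps)
    then show "(h b x - h a x - (w b - w a))\<^sup>2 \<le> 2 * (h b x - w b)\<^sup>2 + 2 * (h a x - w a)\<^sup>2" for x .
  qed
  also have "\<dots> = 2 * (\<integral>x. (h b x - w b)\<^sup>2 \<partial>gauss n) + 2 * (\<integral>x. (h a x - w a)\<^sup>2 \<partial>gauss n)"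
    using i assms by simp
  also have "\<dots> \<le> 48 * (a\<^sup>2 + b\<^sup>2)"
    using h_variance assms by (auto simp: algebra_simps intro!: add_mono)
  finally show ?thesis .
qed

lemma increment_second_moment:
  assumes "0 \<le> a" "0 \<le> b"
  shows "(\<integral>x. (h b x - h a x)\<^sup>2 \<partial>gauss n) \<le> (w b - w a)\<^sup>2 + 48 * (a\<^sup>2 + b\<^sup>2)"
proof -
  let ?H = "\<lambda>x. h b x - h a x"
  have sq: "integrable (gauss n) (\<lambda>x. (?H x)\<^sup>2)"
    using increment_sq_integrable[OF assms, of 0] by simp
  have m: "?H \<in> borel_measurable (gauss n)"
    using h_measurable[OF assms(1)] h_measurable[OF assms(2)] by measurable
  define d where "d = w b - w a"
  have "(\<integral>x. ?H x \<partial>gauss n) = d"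
    unfolding w_def d_def using h_integrable assms by simp
  then have "(\<integral>x. (?H x - d)\<^sup>2 \<partial>gauss n) = (\<integral>x. (?H x)\<^sup>2 \<partial>gauss n) - d\<^sup>2"
    using gauss_second_moment_about(2)[OF m sq, of d] by (simp add: power2_eq_square)
  then show ?thesis
    using increment_variance[OF assms] unfolding d_def[symmetric] by linarith
qed

text \<open>The second moment of the increment is its squared mean plus its variance. Under the
  weight from \<open>err_upper\<close>, a mean at the threshold contributes
  \<open>(C + c)^2 * e^2\<close>, and the variance contributes the multiple of
  \<open>\<sigma>^2\<close>, with \<open>192 = 4 * 48\<close>.\<close>

lemma risk_upper:
  assumes c: "0 < c" "c < C" and e: "0 < e"
    and w: "w (C * e) - w (c * e) \<le> (C\<^sup>2 - c\<^sup>2) * e\<^sup>2 / (2 * \<sigma>)"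
  shows "(\<integral>x. (err x)\<^sup>2 \<partial>gauss n) \<le> (C\<^sup>2 + (C + c)\<^sup>2) * e\<^sup>2 + 192 * (C\<^sup>2 + c\<^sup>2) / (C - c)\<^sup>2 * \<sigma>\<^sup>2"
proof -
  let ?a = "c * e" and ?b = "C * e"
  let ?k = "4 * \<sigma>\<^sup>2 / (?b - ?a)\<^sup>2"
  have ab: "0 \<le> ?a" "?a < ?b" "0 \<le> ?b" using c e by auto
  have k: "?k = 4 * \<sigma>\<^sup>2 / ((C - c)\<^sup>2 * e\<^sup>2)"
    by (simp add: left_diff_distrib[symmetric] power_mult_distrib)
  have sq: "integrable (gauss n) (\<lambda>x. (h ?b x - h ?a x)\<^sup>2)"
    using increment_sq_integrable[OF ab(1,3), of 0] by simp
  have "(\<integral>x. (err x)\<^sup>2 \<partial>gauss n) \<le> (\<integral>x. ?b\<^sup>2 + ?k * (h ?b x - h ?a x)\<^sup>2 \<partial>gauss n)"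
    using err_sq_integrable sq err_upper[OF ab(1,2)] by (intro integral_mono) auto
  also have "\<dots> = ?b\<^sup>2 + ?k * (\<integral>x. (h ?b x - h ?a x)\<^sup>2 \<partial>gauss n)"
    using sq by (simp add: gauss.prob_space)
  also have "\<dots> \<le> ?b\<^sup>2 + ?k * ((w ?b - w ?a)\<^sup>2 + 48 * (?a\<^sup>2 + ?b\<^sup>2))"
    using increment_second_moment[OF ab(1,3)] by (intro add_left_mono mult_left_mono) auto
  also have "\<dots> \<le> ?b\<^sup>2 + ?k * (((C\<^sup>2 - c\<^sup>2) * e\<^sup>2 / (2 * \<sigma>))\<^sup>2 + 48 * (?a\<^sup>2 + ?b\<^sup>2))"
    using w w_mono[OF ab(1)] ab(2) by (intro add_left_mono mult_left_mono add_right_mono power_mono) auto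
  also have "\<dots> = (C\<^sup>2 + (C + c)\<^sup>2) * e\<^sup>2 + 192 * (C\<^sup>2 + c\<^sup>2) / (C - c)\<^sup>2 * \<sigma>\<^sup>2"
  proof -
    have "?k * ((C\<^sup>2 - c\<^sup>2) * e\<^sup>2 / (2 * \<sigma>))\<^sup>2 = (C + c)\<^sup>2 * e\<^sup>2"
    proof -
      have "((C\<^sup>2 - c\<^sup>2) * e\<^sup>2 / (2 * \<sigma>))\<^sup>2 = ((C\<^sup>2 - c\<^sup>2) * e\<^sup>2)\<^sup>2 / (4 * \<sigma>\<^sup>2)"
        by (simp add: power_divide power_mult_distrib)
      also have "((C\<^sup>2 - c\<^sup>2) * e\<^sup>2)\<^sup>2 = ((C - c)\<^sup>2 * e\<^sup>2) * ((C + c)\<^sup>2 * e\<^sup>2)"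
        by algebra
      finally show ?thesis unfolding k using c e sigma_pos by simp
    qed
    moreover have "?k * (48 * (?a\<^sup>2 + ?b\<^sup>2)) = 192 * (C\<^sup>2 + c\<^sup>2) / (C - c)\<^sup>2 * \<sigma>\<^sup>2"
      unfolding k using c e by (simp add: power_mult_distrib distrib_right[symmetric] add.commute)
    ultimately show ?thesis by (simp add: distrib_left distrib_right power_mult_distrib)
  qed
  finally show ?thesis .
qed

text \<open>An error below \<open>c * e / 2\<close> forces the increment below its mean by at least
  \<open>g\<close>, of order \<open>e^2 / \<sigma>\<close>. Its standard deviation is of order
  \<open>e\<close>, so this is improbable once \<open>e\<close> dominates
  \<open>\<sigma>\<close>.\<close>

lemma risk_lower:
  assumes c: "0 < c" "c < C" and e: "0 < e"
    and w: "7 / 8 * ((C\<^sup>2 - c\<^sup>2) * e\<^sup>2 / (2 * \<sigma>)) \<le> w (C * e) - w (c * e)"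
    and big: "12288 * \<sigma>\<^sup>2 \<le> (C - c)\<^sup>2 * e\<^sup>2"
  shows "c\<^sup>2 * e\<^sup>2 / 8 \<le> (\<integral>x. (err x)\<^sup>2 \<partial>gauss n)"
proof -
  let ?a = "c * e" and ?b = "C * e"
  let ?m = "w ?b - w ?a"
  \<comment> \<open>Starting from 7/8 of the threshold, \<open>err_lower\<close> leaves the margin
    \<open>(C - c) * (7 * C - 5 * c) * e^2 / (16 * \<sigma>)\<close>. \<open>g\<close> keeps
    \<open>2 * C\<close> of the second factor; the remainder \<open>5 * (C - c)\<close> is
    nonnegative.\<close>
  define g where "g = (C - c) * C * e\<^sup>2 / (8 * \<sigma>)"
  have ab: "0 < ?a" "?a < ?b" "0 \<le> ?a" "0 \<le> ?b" using c e by auto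
  have g: "g > 0" using c e sigma_pos by (simp add: g_def)
  \<comment> \<open>Markov for \<open>err\<close> and Chebyshev for the increment in one inequality:
    for every \<open>x\<close> one of the summands is at least 1.\<close>
  have pt: "1 \<le> 4 / ?a\<^sup>2 * (err x)\<^sup>2 + 1 / g\<^sup>2 * (h ?b x - h ?a x - ?m)\<^sup>2" for x
  proof (cases "err x \<le> ?a / 2")
    case True
    have "h ?b x - h ?a x \<le> (?b - ?a) * (3 / 4 * ?a) / \<sigma>"
      by (rule err_lower[OF ab(1,2) True])
    also have "\<dots> \<le> 7 / 8 * ((C\<^sup>2 - c\<^sup>2) * e\<^sup>2 / (2 * \<sigma>)) - g"
    proof -
      have "7 / 8 * ((C\<^sup>2 - c\<^sup>2) * e\<^sup>2 / (2 * \<sigma>)) - g - (?b - ?a) * (3 / 4 * ?a) / \<sigma>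
          = (C - c) * (e\<^sup>2 * (5 * (C - c))) / (16 * \<sigma>)"
        unfolding g_def using sigma_pos by (simp add: field_simps power2_eq_square)
      also have "\<dots> \<ge> 0" using c sigma_pos by simp
      finally show ?thesis by simp
    qed
    finally have "g \<le> ?m - (h ?b x - h ?a x)" using w by simp
    then have "g\<^sup>2 \<le> (?m - (h ?b x - h ?a x))\<^sup>2" using g by (intro power_mono) auto
    then have "1 \<le> 1 / g\<^sup>2 * (h ?b x - h ?a x - ?m)\<^sup>2"
      using g by (simp add: power2_commute field_simps)
    then show ?thesis by (simp add: add_increasing)
  next
    case False
    then have "(?a / 2)\<^sup>2 \<le> (err x)\<^sup>2" using ab by (intro power_mono) auto
    then have "?a\<^sup>2 \<le> 4 * (err x)\<^sup>2" by (simp add: power_divide)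
    moreover have "0 < ?a\<^sup>2" using ab(1) by (rule zero_less_power)
    ultimately have "1 \<le> 4 / ?a\<^sup>2 * (err x)\<^sup>2"
      unfolding times_divide_eq_left by (subst le_divide_eq_1_pos)
    then show ?thesis by (simp add: add_increasing2)
  qed
  have "1 = (\<integral>x. (1::real) \<partial>gauss n)" by (simp add: gauss.prob_space)
  also have "\<dots> \<le> (\<integral>x. 4 / ?a\<^sup>2 * (err x)\<^sup>2 + 1 / g\<^sup>2 * (h ?b x - h ?a x - ?m)\<^sup>2 \<partial>gauss n)"
    using err_sq_integrable increment_sq_integrable[OF ab(3,4)] pt
    by (intro integral_mono Bochner_Integration.integrable_add integrable_mult_right) auto
  also have "\<dots> = 4 / ?a\<^sup>2 * (\<integral>x. (err x)\<^sup>2 \<partial>gauss n) + 1 / g\<^sup>2 * (\<integral>x. (h ?b x - h ?a x - ?m)\<^sup>2 \<partial>gauss n)"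
    using err_sq_integrable increment_sq_integrable[OF ab(3,4)]
    by (subst Bochner_Integration.integral_add) (auto intro!: integrable_mult_right)
  also have "\<dots> \<le> 4 / ?a\<^sup>2 * (\<integral>x. (err x)\<^sup>2 \<partial>gauss n) + 1 / g\<^sup>2 * (48 * (?a\<^sup>2 + ?b\<^sup>2))"
    using increment_variance[OF ab(3,4)] by (intro add_left_mono mult_left_mono) auto
  \<comment> \<open>The place where \<open>big\<close> enters: \<open>12288 = 192 * 64\<close>, with
    192 from bounding \<open>?a\<close> by \<open>?b\<close> in \<open>96\<close> times the sum of
    squares, and 64 from the squared 8 in \<open>g\<close>.\<close>
  also have "1 / g\<^sup>2 * (48 * (?a\<^sup>2 + ?b\<^sup>2)) \<le> 1 / 2"
  proof -
    have "?a\<^sup>2 \<le> ?b\<^sup>2" using ab by (intro power_mono) auto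
    then have "96 * (?a\<^sup>2 + ?b\<^sup>2) \<le> 192 * (C\<^sup>2 * e\<^sup>2)" by (simp add: power_mult_distrib)
    also have "\<dots> \<le> g\<^sup>2"
    proof -
      have "12288 * \<sigma>\<^sup>2 * (C\<^sup>2 * e\<^sup>2) \<le> (C - c)\<^sup>2 * e\<^sup>2 * (C\<^sup>2 * e\<^sup>2)"
        using big by (intro mult_right_mono) auto
      show ?thesis
      proof -
        have "192 * (C\<^sup>2 * e\<^sup>2) * (64 * \<sigma>\<^sup>2) \<le> (C - c)\<^sup>2 * C\<^sup>2 * (e\<^sup>2)\<^sup>2"
          using \<open>12288 * \<sigma>\<^sup>2 * (C\<^sup>2 * e\<^sup>2) \<le> (C - c)\<^sup>2 * e\<^sup>2 * (C\<^sup>2 * e\<^sup>2)\<close>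
          by (simp add: power2_eq_square[of "e\<^sup>2"] mult_ac)
        moreover have "g\<^sup>2 = (C - c)\<^sup>2 * C\<^sup>2 * (e\<^sup>2)\<^sup>2 / (64 * \<sigma>\<^sup>2)"
          unfolding g_def by (simp only: power_divide power_mult_distrib) simp
        moreover have "0 < 64 * \<sigma>\<^sup>2" using sigma_pos by simp
        ultimately show ?thesis by (simp only: pos_le_divide_eq)
      qed
    qed
    finally show ?thesis using g by (simp add: field_simps)
  qed
  finally have "1 / 2 \<le> 4 / ?a\<^sup>2 * (\<integral>x. (err x)\<^sup>2 \<partial>gauss n)" by simp
  moreover have "0 < ?a\<^sup>2" using ab(1) by (rule zero_less_power)
  ultimately have "1 / 2 * ?a\<^sup>2 \<le> 4 * (\<integral>x. (err x)\<^sup>2 \<partial>gauss n)"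
    unfolding times_divide_eq_left[of 4] by (simp only: pos_le_divide_eq)
  then show ?thesis by (simp add: power_mult_distrib)
qed

end

section \<open>The worst-case risk\<close>

context convex_body
begin

text \<open>Le Cam's two-point method. Shifting the noise by \<open>a\<close> turns the observation
  from \<open>u\<close> into the one from \<open>v\<close>, so a single estimate would have to be
  close to two points at distance \<open>d\<close>. As \<open>d \<le> \<sigma>\<close>, the density
  \<open>k\<close> of the shift has bounded second moment, and the bound returns to unshifted
  noise.\<close>

lemma two_point_risk:
  assumes sigma: "0 < \<sigma>" and u: "u \<in> K" and v: "v \<in> K"
    and d: "0 < d" "edist n u v = d" "d \<le> \<sigma>"
  shows "\<exists>\<mu>\<in>K. d\<^sup>2 / 16 \<le> (\<integral>x. (edist n (lse n K (obs n \<mu> \<sigma> x)) \<mu>)\<^sup>2 \<partial>gauss n)"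
proof -
  interpret U: lse_risk n K u \<sigma> by unfold_locales (use sigma u in auto)
  interpret V: lse_risk n K v \<sigma> by unfold_locales (use sigma v in auto)
  define a where "a i = (v i - u i) / \<sigma>" for i
  define k where "k x = exp (ip n x a - ip n a a / 2)" for x
  define S where "S x = (\<lambda>i\<in>{..<n}. x i + a i)" for x
  \<comment> \<open>Truncation at 1 ensures that the square of \<open>p\<close> is at most
    \<open>p\<close>, which is needed when \<open>p\<close> is weighted by the unbounded
    \<open>k\<close>.\<close>
  define p where "p x = min 1 ((U.err x)\<^sup>2 / d\<^sup>2)" for x
  define q where "q x = min 1 ((V.err x)\<^sup>2 / d\<^sup>2)" for x
  have [measurable]: "S \<in> measurable (gauss n) (gauss n)" unfolding S_def by measurable
  have km[measurable]: "k \<in> borel_measurable (gauss n)" unfolding k_def by measurable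
  have pm[measurable]: "p \<in> borel_measurable (gauss n)" unfolding p_def by measurable
  have qm[measurable]: "q \<in> borel_measurable (gauss n)" unfolding q_def by measurable
  have p01: "0 \<le> p x" "p x \<le> 1" for x by (auto simp: p_def)
  have q01: "0 \<le> q x" "q x \<le> 1" for x by (auto simp: q_def)
  have aa: "ip n a a \<le> 1"
  proof -
    have "ip n a a = (edist n v u)\<^sup>2 / \<sigma>\<^sup>2"
      unfolding edist_sq by (simp add: ip_def a_def sum_divide_distrib power2_eq_square)
    also have "\<dots> \<le> 1" using d sigma by (simp add: edist_commute power_mono)
    finally show ?thesis .
  qed
  have obs: "obs n u \<sigma> (S x) = obs n v \<sigma> x" for x
    using sigma by (auto simp: obs_def S_def a_def field_simps)
  have sep: "1 / 2 \<le> p (S x) + q x" for x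
  proof (cases "U.err (S x) < d \<and> V.err x < d")
    case True
    have pq: "p (S x) = (U.err (S x))\<^sup>2 / d\<^sup>2" "q x = (V.err x)\<^sup>2 / d\<^sup>2"
      using True d U.err_nonneg V.err_nonneg by (auto simp: p_def q_def intro!: min_absorb2 power_mono)
    have "d \<le> U.err (S x) + V.err x"
      using edist_triangle[of n u v "lse n K (obs n v \<sigma> x)"] d(2)
      by (simp add: U.err_def V.err_def obs edist_commute)
    then have "d\<^sup>2 \<le> (U.err (S x) + V.err x)\<^sup>2" using d by (intro power_mono) auto
    also have "\<dots> \<le> 2 * ((U.err (S x))\<^sup>2 + (V.err x)\<^sup>2)"
      using zero_le_power2[of "U.err (S x) - V.err x"] by (simp add: power2_eq_square algebra_simps)
    finally show ?thesis unfolding pq using d by (simp add: field_simps)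
  next
    case False
    then have "p (S x) = 1 \<or> q x = 1"
      using d by (auto simp: p_def q_def not_less intro!: min_absorb1 power_mono)
    then show ?thesis using p01[of "S x"] q01[of x] by auto
  qed
  have k1: "(\<integral>\<^sup>+x. ennreal (k x) \<partial>gauss n) = 1"
    using gauss_shift[of "\<lambda>_. 1" n a] by (simp add: k_def gauss.emeasure_space_1)
  \<comment> \<open>The shift formula trades one factor \<open>k\<close> for a shift of the other,
    which gains \<open>exp (ip n a a)\<close>; this is at most \<open>exp 1\<close>, hence at most
    3.\<close>
  have k2: "(\<integral>\<^sup>+x. ennreal ((k x)\<^sup>2) \<partial>gauss n) \<le> 3"
  proof -
    have "(\<integral>\<^sup>+x. ennreal ((k x)\<^sup>2) \<partial>gauss n) = (\<integral>\<^sup>+x. ennreal (k x) * ennreal (k x) \<partial>gauss n)"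
      by (simp add: ennreal_mult[symmetric] k_def power2_eq_square)
    also have "\<dots> = (\<integral>\<^sup>+x. ennreal (k (S x)) \<partial>gauss n)"
      unfolding S_def using gauss_shift[of "\<lambda>x. ennreal (k x)" n a] by (simp add: k_def)
    also have "\<dots> = (\<integral>\<^sup>+x. ennreal (exp (ip n a a)) * ennreal (k x) \<partial>gauss n)"
    proof (rule nn_integral_cong)
      fix x
      have "ip n (S x) a = ip n x a + ip n a a"
        by (simp add: ip_def S_def sum.distrib[symmetric] distrib_right)
      then have "k (S x) = exp (ip n a a) * k x" by (simp add: k_def exp_add[symmetric])
      then show "ennreal (k (S x)) = ennreal (exp (ip n a a)) * ennreal (k x)"
        by (simp add: ennreal_mult k_def)
    qed
    also have "\<dots> = ennreal (exp (ip n a a))" by (simp add: nn_integral_cmult k1)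
    also have "\<dots> \<le> ennreal 3"
      using aa exp_le by (intro ennreal_leI) (auto intro: order_trans[of _ "exp 1"])
    finally show ?thesis by simp
  qed
  have ip1: "integrable (gauss n) p" and iq1: "integrable (gauss n) q"
    by (rule gauss.integrable_const_bound[where B=1]; use p01 q01 in auto)+
  have "(\<integral>\<^sup>+x. ennreal (p (S x)) \<partial>gauss n) = (\<integral>\<^sup>+x. ennreal (k x) * ennreal (p x) \<partial>gauss n)"
    unfolding S_def k_def by (rule gauss_shift) simp
  also have "\<dots> \<le> (\<integral>\<^sup>+x. ennreal (4 * p x) + ennreal ((1 / 16) * (k x)\<^sup>2) \<partial>gauss n)"
  proof (rule nn_integral_mono)
    fix x
    \<comment> \<open>The weight 1/16 keeps the contribution of \<open>k\<close> at 3/16, safely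
      below the separation 1/2.\<close>
    have "k x * p x \<le> 4 * (p x)\<^sup>2 + (1 / 16) * (k x)\<^sup>2"
      using zero_le_power2[of "8 * p x - k x"] by (simp add: power2_eq_square algebra_simps)
    also have "(p x)\<^sup>2 \<le> p x" using p01[of x] by (simp add: power2_eq_square mult_left_le)
    finally show "ennreal (k x) * ennreal (p x) \<le> ennreal (4 * p x) + ennreal ((1 / 16) * (k x)\<^sup>2)"
      using p01[of x] by (auto simp: ennreal_plus[symmetric] ennreal_mult[symmetric] k_def simp del: ennreal_plus intro!: ennreal_leI)
  qed
  also have "\<dots> = ennreal (\<integral>x. 4 * p x \<partial>gauss n) + ennreal (1 / 16) * (\<integral>\<^sup>+x. ennreal ((k x)\<^sup>2) \<partial>gauss n)"
  proof -
    have "(\<integral>\<^sup>+x. ennreal (4 * p x) \<partial>gauss n) = ennreal (\<integral>x. 4 * p x \<partial>gauss n)"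
      using ip1 p01 by (intro nn_integral_eq_integral) auto
    moreover have "(\<integral>\<^sup>+x. ennreal ((1 / 16) * (k x)\<^sup>2) \<partial>gauss n) = ennreal (1 / 16) * (\<integral>\<^sup>+x. ennreal ((k x)\<^sup>2) \<partial>gauss n)"
      by (subst ennreal_mult) (auto simp: nn_integral_cmult)
    ultimately show ?thesis by (subst nn_integral_add) auto
  qed
  also have "\<dots> \<le> ennreal (4 * (\<integral>x. p x \<partial>gauss n)) + ennreal (1 / 16) * 3"
    using k2 by (intro add_mono mult_left_mono) auto
  finally have shifted: "(\<integral>\<^sup>+x. ennreal (p (S x)) \<partial>gauss n) \<le> ennreal (4 * (\<integral>x. p x \<partial>gauss n)) + ennreal (1 / 16) * 3" .
  have "ennreal (1 / 2) = (\<integral>\<^sup>+x. ennreal (1 / 2) \<partial>gauss n)"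
    by (simp add: gauss.emeasure_space_1)
  also have "\<dots> \<le> (\<integral>\<^sup>+x. ennreal (p (S x)) + ennreal (q x) \<partial>gauss n)"
    using p01 q01 by (intro nn_integral_mono, subst ennreal_plus[symmetric]) (rule p01 q01 ennreal_leI sep)+
  also have "\<dots> = (\<integral>\<^sup>+x. ennreal (p (S x)) \<partial>gauss n) + (\<integral>\<^sup>+x. ennreal (q x) \<partial>gauss n)"
    by (rule nn_integral_add) auto
  also have "\<dots> \<le> ennreal (4 * (\<integral>x. p x \<partial>gauss n)) + ennreal (1 / 16) * 3 + (\<integral>\<^sup>+x. ennreal (q x) \<partial>gauss n)"
    by (rule add_right_mono[OF shifted])
  also have "(\<integral>\<^sup>+x. ennreal (q x) \<partial>gauss n) = ennreal (\<integral>x. q x \<partial>gauss n)"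
    using iq1 q01 by (intro nn_integral_eq_integral) auto
  also have "ennreal (4 * (\<integral>x. p x \<partial>gauss n)) + ennreal (1 / 16) * 3 + ennreal (\<integral>x. q x \<partial>gauss n)
     = ennreal (4 * (\<integral>x. p x \<partial>gauss n) + 3 / 16 + (\<integral>x. q x \<partial>gauss n))"
  proof -
    have "ennreal (1 / 16) * 3 = ennreal (3 / 16)"
      using ennreal_mult[of "1/16" 3] by simp
    then show ?thesis using p01 q01 by (simp add: ennreal_plus[symmetric] integral_nonneg_AE del: ennreal_plus)
  qed
  finally have "1 / 2 \<le> 4 * (\<integral>x. p x \<partial>gauss n) + 3 / 16 + (\<integral>x. q x \<partial>gauss n)"
    using p01 q01 by (subst (asm) ennreal_le_iff) (auto intro!: add_nonneg_nonneg integral_nonneg_AE)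
  \<comment> \<open>If both integrals were below 1/16, the right-hand side would be below
    \<open>4/16 + 3/16 + 1/16 = 1/2\<close>.\<close>
  then have "1 / 16 \<le> (\<integral>x. p x \<partial>gauss n) \<or> 1 / 16 \<le> (\<integral>x. q x \<partial>gauss n)" by linarith
  moreover have "(\<integral>x. p x \<partial>gauss n) \<le> (\<integral>x. (U.err x)\<^sup>2 / d\<^sup>2 \<partial>gauss n)"
    using ip1 U.err_sq_integrable by (intro integral_mono) (auto simp: p_def)
  moreover have "(\<integral>x. q x \<partial>gauss n) \<le> (\<integral>x. (V.err x)\<^sup>2 / d\<^sup>2 \<partial>gauss n)"
    using iq1 V.err_sq_integrable by (intro integral_mono) (auto simp: q_def)
  ultimately have "1 / 16 \<le> (\<integral>x. (U.err x)\<^sup>2 \<partial>gauss n) / d\<^sup>2 \<or> 1 / 16 \<le> (\<integral>x. (V.err x)\<^sup>2 \<partial>gauss n) / d\<^sup>2"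
    unfolding integral_divide_zero by linarith
  then have "d\<^sup>2 / 16 \<le> (\<integral>x. (U.err x)\<^sup>2 \<partial>gauss n) \<or> d\<^sup>2 / 16 \<le> (\<integral>x. (V.err x)\<^sup>2 \<partial>gauss n)"
    using d by (simp add: field_simps)
  then show ?thesis using u v unfolding U.err_def V.err_def by blast
qed

section \<open>From the risk at one point to the worst case\<close>

lemma lse_riskI: "\<mu> \<in> K \<Longrightarrow> 0 < \<sigma> \<Longrightarrow> lse_risk n K \<mu> \<sigma>"
  by unfold_locales

abbreviation risk :: "real \<Rightarrow> (nat \<Rightarrow> real) \<Rightarrow> real" where
  "risk \<sigma> \<mu> \<equiv> \<integral>x. (edist n (lse n K (obs n \<mu> \<sigma> x)) \<mu>)\<^sup>2 \<partial>gauss n"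

lemma risk_le_ediam: "\<mu> \<in> K \<Longrightarrow> 0 < \<sigma> \<Longrightarrow> risk \<sigma> \<mu> \<le> (ediam n K)\<^sup>2"
  using lse_risk.err_sq_integral_le[OF lse_riskI] by (simp add: lse_risk.err_def[OF lse_riskI])

lemma epsK_le:
  assumes "0 \<le> B" "\<And>\<mu>. \<mu> \<in> K \<Longrightarrow> risk \<sigma> \<mu> \<le> B\<^sup>2"
  shows "epsK n K \<sigma> \<le> B"
  unfolding epsK_def using assms K_ne by (intro real_le_lsqrt cSUP_least) auto

lemma le_epsK:
  assumes "0 < \<sigma>" "\<mu> \<in> K" "B\<^sup>2 \<le> risk \<sigma> \<mu>"
  shows "B \<le> epsK n K \<sigma>"
proof -
  have "bdd_above (risk \<sigma> ` K)"
    using risk_le_ediam assms(1) by (intro bdd_aboveI2) blast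
  then have "risk \<sigma> \<mu> \<le> (SUP \<mu>\<in>K. risk \<sigma> \<mu>)" using assms(2) by (rule cSUP_upper2) simp
  with assms(3) show ?thesis unfolding epsK_def by (intro real_le_rsqrt) simp
qed

lemma epsK_le_ediam: "0 < \<sigma> \<Longrightarrow> epsK n K \<sigma> \<le> ediam n K"
  by (rule epsK_le[OF ediam_nonneg risk_le_ediam])

text \<open>A pair at distance more than half the diameter is brought together along its segment
  until the distance is at most \<open>\<sigma>\<close>, as \<open>two_point_risk\<close> requires.
  The 8 is the square root of 16 times the 2 lost in choosing the pair.\<close>

lemma min_le_epsK:
  assumes "0 < \<sigma>"
  shows "min \<sigma> (ediam n K) / 8 \<le> epsK n K \<sigma>"
proof (cases "ediam n K = 0")
  case True
  obtain \<mu> where "\<mu> \<in> K" using K_ne by blast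
  then have "0 \<le> epsK n K \<sigma>" by (rule le_epsK[OF assms]) simp
  then show ?thesis using True assms by simp
next
  case False
  then have d: "0 < ediam n K" using ediam_nonneg by simp
  have "ediam n K / 2 < Sup {edist n u v | u v. u \<in> K \<and> v \<in> K}"
    using d unfolding ediam_def by linarith
  moreover have "{edist n u v | u v. u \<in> K \<and> v \<in> K} \<noteq> {}" using K_ne by blast
  ultimately obtain y where "y \<in> {edist n u v | u v. u \<in> K \<and> v \<in> K}" "ediam n K / 2 < y"
    by (rule less_cSupE)
  then obtain u v where uv: "u \<in> K" "v \<in> K" "ediam n K / 2 < edist n u v"
    by blast
  define l where "l = edist n u v"
  define \<delta> where "\<delta> = min \<sigma> l"
  define t where "t = \<delta> / l"
  have l: "0 < l" using uv d by (simp add: l_def)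
  have \<delta>: "0 < \<delta>" "\<delta> \<le> \<sigma>" using l assms by (auto simp: \<delta>_def)
  have t: "0 \<le> t" "t \<le> 1" "t * l = \<delta>" using l \<delta> by (auto simp: t_def \<delta>_def)
  let ?v = "\<lambda>i. (1 - t) * u i + t * v i"
  have "edist n u ?v = enorm n (\<lambda>i. t * (u i - v i))"
    unfolding edist_enorm by (rule L2_set_cong) (auto simp: algebra_simps)
  also have "\<dots> = \<delta>" using t by (simp add: L2_set_right_distrib[symmetric] l_def edist_enorm)
  finally have "edist n u ?v = \<delta>" .
  from two_point_risk[OF assms uv(1) convexD[OF uv(1,2) t(1,2)] \<delta>(1) this \<delta>(2)]
  obtain \<mu> where \<mu>: "\<mu> \<in> K" "\<delta>\<^sup>2 / 16 \<le> risk \<sigma> \<mu>" by blast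
  then have "\<delta> / 4 \<le> epsK n K \<sigma>"
    by (intro le_epsK[OF assms \<mu>(1)]) (simp add: power_divide)
  moreover have "min \<sigma> (ediam n K) \<le> 2 * \<delta>" using uv(3) assms by (auto simp: \<delta>_def l_def min_def)
  ultimately show ?thesis by simp
qed

end

section \<open>The critical radius and its comparison with the risk\<close>

locale epsbar_setup = convex_body +
  fixes \<sigma> c C :: real
  assumes sigma: "0 < \<sigma>" and c_pos: "0 < c" and cC: "c < C"
begin

abbreviation gap :: "real \<Rightarrow> (nat \<Rightarrow> real) \<Rightarrow> real" where
  "gap \<epsilon> \<mu> \<equiv> lgw n K \<mu> (C * \<epsilon>) - lgw n K \<mu> (c * \<epsilon>)"

abbreviation thr :: "real \<Rightarrow> real" where
  "thr \<epsilon> \<equiv> (C\<^sup>2 - c\<^sup>2) * \<epsilon>\<^sup>2 / (2 * \<sigma>)"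

definition E :: "real set" where
  "E = {\<epsilon>. 0 \<le> \<epsilon> \<and> (SUP \<mu>\<in>K. gap \<epsilon> \<mu>) \<ge> thr \<epsilon>}"

lemma epsbar_eq: "epsbar n K \<sigma> C c = Sup E"
  by (simp add: epsbar_def E_def)

lemma thr_pos: "0 < \<epsilon> \<Longrightarrow> 0 < thr \<epsilon>"
  using sigma c_pos cC by (simp add: power_strict_mono)

lemma gap_eq:
  assumes "\<mu> \<in> K" "0 \<le> \<epsilon>"
  shows "gap \<epsilon> \<mu> = lse_risk.w n K \<mu> (C * \<epsilon>) - lse_risk.w n K \<mu> (c * \<epsilon>)"
  using lse_risk.lgw_eq_w[OF lse_riskI[OF assms(1) sigma]] assms(2) c_pos cC by simp

lemma gap_bdd:
  assumes "0 \<le> \<epsilon>"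
  shows "bdd_above (gap \<epsilon> ` K)"
proof (rule bdd_aboveI2)
  fix \<mu> assume mu: "\<mu> \<in> K"
  interpret lse_risk n K \<mu> \<sigma> by (rule lse_riskI[OF mu sigma])
  show "gap \<epsilon> \<mu> \<le> (\<integral>x. enorm n x \<partial>gauss n) * (C * \<epsilon>)"
    unfolding gap_eq[OF mu assms] using w_le[of "C * \<epsilon>"] w_nonneg[of "c * \<epsilon>"] assms c_pos cC by simp
qed

text \<open>Beyond \<open>ediam n K / c\<close> both balls contain all of \<open>K\<close>, so the
  widths cancel while the threshold stays positive. \<open>Sup E\<close> is a genuine supremum only
  because of such a bound.\<close>

lemma E_bdd: "bdd_above E"
proof (rule bdd_aboveI)
  fix \<epsilon> assume e: "\<epsilon> \<in> E"
  show "\<epsilon> \<le> ediam n K / c"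
  proof (rule ccontr)
    assume "\<not> ?thesis"
    then have ce: "ediam n K < c * \<epsilon>" using c_pos by (simp add: field_simps)
    then have pos: "0 < \<epsilon>" using ediam_nonneg c_pos by (metis order.strict_trans1 zero_less_mult_pos)
    then have "c * \<epsilon> < C * \<epsilon>" using cC by simp
    with ce have "{t\<in>K. edist n t \<mu> \<le> C * \<epsilon>} = {t\<in>K. edist n t \<mu> \<le> c * \<epsilon>}" if "\<mu> \<in> K" for \<mu>
      using edist_le_ediam[OF _ that] by fastforce
    then have "gap \<epsilon> \<mu> = 0" if "\<mu> \<in> K" for \<mu> using that by (simp add: lgw_def)
    then have "(SUP \<mu>\<in>K. gap \<epsilon> \<mu>) = 0" using K_ne by simp
    then show False using e thr_pos[OF pos] by (simp add: E_def)
  qed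
qed

lemma zero_in_E: "0 \<in> E"
  using K_ne by (simp add: E_def)

lemma epsbar_nonneg: "0 \<le> epsbar n K \<sigma> C c"
  unfolding epsbar_eq by (rule cSup_upper[OF zero_in_E E_bdd])

lemma gap_above_epsbar:
  assumes "epsbar n K \<sigma> C c < \<epsilon>" "\<mu> \<in> K"
  shows "gap \<epsilon> \<mu> \<le> thr \<epsilon>"
proof -
  have e: "0 \<le> \<epsilon>" using assms(1) epsbar_nonneg by simp
  have "\<epsilon> \<notin> E" using assms(1) cSup_upper[OF _ E_bdd, of \<epsilon>] by (auto simp: epsbar_eq)
  then have "(SUP \<mu>\<in>K. gap \<epsilon> \<mu>) < thr \<epsilon>" using e by (simp add: E_def)
  moreover have "gap \<epsilon> \<mu> \<le> (SUP \<mu>\<in>K. gap \<epsilon> \<mu>)" by (rule cSUP_upper[OF assms(2) gap_bdd[OF e]])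
  ultimately show ?thesis by simp
qed

text \<open>Neither the supremum over radii nor the one over \<open>K\<close> need be attained; half
  of the radius and an eighth of the threshold are given up to obtain witnesses.\<close>

lemma gap_near_epsbar:
  assumes "0 < epsbar n K \<sigma> C c"
  obtains \<epsilon> \<mu> where "epsbar n K \<sigma> C c / 2 < \<epsilon>" "\<mu> \<in> K" "7 / 8 * thr \<epsilon> < gap \<epsilon> \<mu>"
proof -
  have "epsbar n K \<sigma> C c / 2 < Sup E" using assms unfolding epsbar_eq by linarith
  moreover have "E \<noteq> {}" using zero_in_E by blast
  ultimately obtain \<epsilon> where e: "\<epsilon> \<in> E" "epsbar n K \<sigma> C c / 2 < \<epsilon>"
    by (rule less_cSupE)
  have pos: "0 < \<epsilon>" using e(2) assms by simp
  have "7 / 8 * thr \<epsilon> < (SUP \<mu>\<in>K. gap \<epsilon> \<mu>)" using e(1) thr_pos[OF pos] by (simp add: E_def)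
  then obtain \<mu> where "\<mu> \<in> K" "7 / 8 * thr \<epsilon> < gap \<epsilon> \<mu>"
    using less_cSUP_iff[OF K_ne gap_bdd] pos by (auto simp: less_imp_le)
  with e(2) show ?thesis by (rule that)
qed

text \<open>The radius \<open>e\<close> is strictly above \<open>epsbar\<close>, so no
  \<open>\<mu>\<close> exceeds the threshold there; it is positive even if \<open>epsbar\<close> is
  0; and it is at least \<open>\<sigma>\<close>, so it absorbs the \<open>\<sigma>\<close> term of
  \<open>risk_upper\<close>.\<close>

lemma epsK_upper:
  "epsK n K \<sigma> \<le> sqrt (C\<^sup>2 + (C + c)\<^sup>2 + 192 * (C\<^sup>2 + c\<^sup>2) / (C - c)\<^sup>2) * (epsbar n K \<sigma> C c + \<sigma>)"
proof (rule epsK_le)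
  let ?A = "C\<^sup>2 + (C + c)\<^sup>2" and ?B = "192 * (C\<^sup>2 + c\<^sup>2) / (C - c)\<^sup>2"
  define e where "e = epsbar n K \<sigma> C c + \<sigma>"
  have e: "epsbar n K \<sigma> C c < e" "0 < e" "\<sigma> \<le> e" using sigma epsbar_nonneg by (auto simp: e_def)
  show "0 \<le> sqrt (?A + ?B) * (epsbar n K \<sigma> C c + \<sigma>)" using e(2) by (simp add: e_def)
  fix \<mu> assume mu: "\<mu> \<in> K"
  interpret lse_risk n K \<mu> \<sigma> by (rule lse_riskI[OF mu sigma])
  have "risk \<sigma> \<mu> \<le> ?A * e\<^sup>2 + ?B * \<sigma>\<^sup>2"
    using risk_upper[OF c_pos cC e(2)] gap_above_epsbar[OF e(1) mu] e(2)
    by (simp add: gap_eq[OF mu] err_def)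
  also have "\<dots> \<le> ?A * e\<^sup>2 + ?B * e\<^sup>2"
    using e sigma by (intro add_left_mono mult_left_mono power_mono) auto
  also have "\<dots> = (sqrt (?A + ?B) * e)\<^sup>2"
    by (simp add: power_mult_distrib distrib_right)
  finally show "risk \<sigma> \<mu> \<le> (sqrt (?A + ?B) * (epsbar n K \<sigma> C c + \<sigma>))\<^sup>2" unfolding e_def .
qed

text \<open>The witness radius is only known to exceed half of \<open>epsbar\<close>. Hence
  \<open>222 = 2 * 111\<close>, where \<open>111^2 = 12321\<close> just passes the 12288 of
  \<open>risk_lower\<close>, and \<open>c / 6\<close>, which becomes \<open>c / 3\<close> at the
  witness, with 9 above the required 8.\<close>

lemma epsK_lower:
  assumes "222 / (C - c) * \<sigma> \<le> epsbar n K \<sigma> C c"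
  shows "c / 6 * epsbar n K \<sigma> C c \<le> epsK n K \<sigma>"
proof -
  let ?e = "epsbar n K \<sigma> C c"
  have "0 < 222 / (C - c) * \<sigma>" using sigma cC by simp
  then have "0 < ?e" using assms by simp
  then obtain \<epsilon> \<mu> where em: "?e / 2 < \<epsilon>" "\<mu> \<in> K" "7 / 8 * thr \<epsilon> < gap \<epsilon> \<mu>"
    by (rule gap_near_epsbar)
  interpret lse_risk n K \<mu> \<sigma> by (rule lse_riskI[OF em(2) sigma])
  have pos: "0 < \<epsilon>" using em(1) \<open>0 < ?e\<close> by simp
  have "222 * \<sigma> \<le> (C - c) * ?e" using assms cC by (simp add: field_simps)
  also have "\<dots> \<le> (C - c) * (2 * \<epsilon>)" using em(1) cC by (intro mult_left_mono) auto
  finally have "111 * \<sigma> \<le> (C - c) * \<epsilon>" unfolding mult.left_commute[of "C - c"] by linarith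
  then have "(111 * \<sigma>)\<^sup>2 \<le> ((C - c) * \<epsilon>)\<^sup>2" using sigma by (intro power_mono) auto
  moreover have "12288 * \<sigma>\<^sup>2 \<le> (111 * \<sigma>)\<^sup>2"
    unfolding power_mult_distrib by (intro mult_right_mono) auto
  ultimately have big: "12288 * \<sigma>\<^sup>2 \<le> (C - c)\<^sup>2 * \<epsilon>\<^sup>2"
    unfolding power_mult_distrib by (rule order_trans[rotated])
  have "c\<^sup>2 * \<epsilon>\<^sup>2 / 8 \<le> risk \<sigma> \<mu>"
    using risk_lower[OF c_pos cC pos _ big] em(3) pos by (simp add: gap_eq[OF em(2)] err_def)
  moreover have "(c / 6 * ?e)\<^sup>2 \<le> c\<^sup>2 * \<epsilon>\<^sup>2 / 8"
  proof -
    have "(c / 6 * ?e)\<^sup>2 \<le> (c / 3 * \<epsilon>)\<^sup>2"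
      using em(1) c_pos \<open>0 < ?e\<close> by (intro power_mono) auto
    also have "\<dots> = c\<^sup>2 * \<epsilon>\<^sup>2 / 9" by (simp add: power_mult_distrib power_divide)
    also have "\<dots> \<le> c\<^sup>2 * \<epsilon>\<^sup>2 / 8" by (intro divide_left_mono) auto
    finally show ?thesis .
  qed
  ultimately show ?thesis by (intro le_epsK[OF sigma em(2)]) simp
qed

end

theorem mainTheorem6:
  fixes C c :: real
  assumes "0 < c" and "c < 1" and "1 < C"
  shows "\<exists>L0>0. \<forall>L\<ge>L0. \<exists>a>0. \<exists>b>0.
    \<forall>(n::nat) (K::(nat \<Rightarrow> real) set) (\<sigma>::real).
      K \<subseteq> Rn n \<longrightarrow> K \<noteq> {} \<longrightarrow> eclosed n K \<longrightarrow> econvex K \<longrightarrow>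
      ebounded n K \<longrightarrow> 0 < \<sigma> \<longrightarrow>
      (epsbar n K \<sigma> C c \<ge> L * \<sigma> \<longrightarrow>
         a * epsbar n K \<sigma> C c \<le> epsK n K \<sigma> \<and> epsK n K \<sigma> \<le> b * epsbar n K \<sigma> C c) \<and>
      (epsbar n K \<sigma> C c < L * \<sigma> \<longrightarrow>
         a * min \<sigma> (ediam n K) \<le> epsK n K \<sigma> \<and> epsK n K \<sigma> \<le> b * min \<sigma> (ediam n K))"
proof -
  have cC: "c < C" using assms by simp
  define A where "A = sqrt (C\<^sup>2 + (C + c)\<^sup>2 + 192 * (C\<^sup>2 + c\<^sup>2) / (C - c)\<^sup>2)"
  have A: "0 \<le> A" by (simp add: A_def)
  define a where "a = min (c / 6) (1 / 8)"
  have a: "0 < a" "a \<le> c / 6" "a \<le> 1 / 8" using assms(1) by (auto simp: a_def)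
  \<comment> \<open>The summands of \<open>b\<close> serve, in this order, the bound by the
    diameter, the bound by \<open>\<sigma>\<close> below the switch at \<open>L * \<sigma>\<close>,
    and the bound by \<open>epsbar\<close> above it. Only \<open>b\<close> depends on
    \<open>L\<close>.\<close>
  have main: "(epsbar n K \<sigma> C c \<ge> L * \<sigma> \<longrightarrow>
         a * epsbar n K \<sigma> C c \<le> epsK n K \<sigma> \<and> epsK n K \<sigma> \<le> b * epsbar n K \<sigma> C c) \<and>
      (epsbar n K \<sigma> C c < L * \<sigma> \<longrightarrow>
         a * min \<sigma> (ediam n K) \<le> epsK n K \<sigma> \<and> epsK n K \<sigma> \<le> b * min \<sigma> (ediam n K))"
    if L: "222 / (C - c) \<le> L" and b: "b = 1 + A * (1 + L) + A * (1 + 1 / L)"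
      and K: "K \<subseteq> Rn n" "K \<noteq> {}" "eclosed n K" "econvex K" "ebounded n K" and \<sigma>: "0 < \<sigma>"
    for L b n K \<sigma>
  proof -
    interpret epsbar_setup n K \<sigma> c C by unfold_locales (use K \<sigma> assms cC in auto)
    let ?e = "epsbar n K \<sigma> C c"
    have Lpos: "0 < L" using L cC by (intro less_le_trans[OF _ L]) simp
    have b1: "1 \<le> b" "A * (1 + L) \<le> b" "A * (1 + 1 / L) \<le> b" using A Lpos by (auto simp: b)
    have up: "epsK n K \<sigma> \<le> A * (?e + \<sigma>)" using epsK_upper by (simp add: A_def)
    show ?thesis
    proof (intro conjI impI)
      assume e: "L * \<sigma> \<le> ?e"
      have "222 / (C - c) * \<sigma> \<le> L * \<sigma>" using L \<sigma> by (intro mult_right_mono) auto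
      then have "c / 6 * ?e \<le> epsK n K \<sigma>" using e by (intro epsK_lower) simp
      then show "a * ?e \<le> epsK n K \<sigma>"
        using mult_right_mono[OF a(2) epsbar_nonneg] by simp
      have "\<sigma> \<le> 1 / L * ?e" using e Lpos by (simp add: field_simps)
      then have "A * (?e + \<sigma>) \<le> A * (1 + 1 / L) * ?e"
        using mult_left_mono[OF _ A, of "?e + \<sigma>" "(1 + 1 / L) * ?e"] by (simp add: distrib_right mult.assoc)
      also have "\<dots> \<le> b * ?e" using b1(3) epsbar_nonneg by (rule mult_right_mono)
      finally show "epsK n K \<sigma> \<le> b * ?e" using up by simp
    next
      assume e: "?e < L * \<sigma>"
      have "0 \<le> min \<sigma> (ediam n K)" using \<sigma> ediam_nonneg by simp
      from mult_right_mono[OF a(3) this] min_le_epsK[OF \<sigma>]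
      show "a * min \<sigma> (ediam n K) \<le> epsK n K \<sigma>" by linarith
      have "A * (?e + \<sigma>) \<le> A * ((1 + L) * \<sigma>)"
        using e A by (intro mult_left_mono) (auto simp: distrib_right)
      also have "\<dots> \<le> b * \<sigma>" using mult_right_mono[OF b1(2), of \<sigma>] \<sigma> by (simp add: mult.assoc)
      finally have 1: "epsK n K \<sigma> \<le> b * \<sigma>" using up by simp
      have "ediam n K \<le> b * ediam n K" using mult_right_mono[OF b1(1) ediam_nonneg] by simp
      then have 2: "epsK n K \<sigma> \<le> b * ediam n K" using epsK_le_ediam[OF \<sigma>] by simp
      show "epsK n K \<sigma> \<le> b * min \<sigma> (ediam n K)" using 1 2 by (simp add: min_def)
    qed
  qed
  have L0: "0 < 222 / (C - c)" using cC by simp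
  have b0: "0 < 1 + A * (1 + L) + A * (1 + 1 / L)" if "222 / (C - c) \<le> L" for L
    using A less_le_trans[OF L0 that] by (simp add: add_pos_nonneg)
  show ?thesis
  proof (rule exI[of _ "222 / (C - c)"], intro conjI L0 allI impI, goal_cases)
    case L: (1 L)
    show ?case
    proof (rule exI[of _ a], rule conjI[OF a(1)], rule exI, rule conjI[OF b0[OF L]],
        intro allI impI, goal_cases)
      case (1 n K \<sigma>)
      then show ?case by (rule main[OF L refl])
    qed
  qed
qed

end
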